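(* Let $\mathcal{M}\subseteq\mathcal{H}$ be an invariant subspace of the Bergman shift $B$, and let $q(z,w)$ be a function in the wandering subspace $\mathcal{M}\ominus B\mathcal{M}$ of $\mathcal{M}$. Then there is a constant $c$ (depending on $q$) such that $$\sum_{j=0}^{\infty}\left|T_{w}^{*j}q(0,w)\right|^{2}=c\qquad\text{for all } w\in\partial\mathbb{D}.$$
   Context: $\mathbb{D}$ is the open unit disc, $\mathbb{T}=\partial\mathbb{D}$ the unit circle. $H^2(\mathbb{T})$ is the Hardy space of the circle and $H^2(\mathbb{T}^2)=H^2(\mathbb{T})\otimes H^2(\mathbb{T})$ is the Hardy space of the bidisc, with variables $z,w$. Let $p_n(z,w)=\sum_{i=0}^{n}z^iw^{n-i}$ for $n\ge 0$, and let $\mathcal{H}$ be the closed linear span of $\{p_n\}_{n\ge0}$ in $H^2(\mathbb{T}^2)$; equivalently $\mathcal{H}=H^2(\mathbb{T}^2)\ominus[z-w]$, where $[z-w]$ is the closure of $(z-w)H^2(\mathbb{T}^2)$. Let $T_z,T_w$ be multiplication by $z$, $w$ on $H^2(\mathbb{T}^2)$, and let $P_{\mathcal{H}}$ be the orthogonal projection onto $\mathcal{H}$. The operator $B=P_{\mathcal{H}}T_z|_{\mathcal{H}}=P_{\mathcal{H}}T_w|_{\mathcal{H}}$ on $\mathcal{H}$ is unitarily equivalent to the Bergman shift (multiplication by the coordinate function on the Bergman space $L^2_a(\mathbb{D})$) and is called the Bergman shift here. An invariant subspace of $B$ is a closed subspace $\mathcal{M}\subseteq\mathcal{H}$ with $B\mathcal{M}\subseteq\mathcal{M}$;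 its wandering subspace is $\mathcal{M}\ominus B\mathcal{M}=\mathcal{M}\cap(B\mathcal{M})^{\perp}$. For $q\in\mathcal{H}$, $q(0,w)$ denotes the function in $H^2(\mathbb{T})$ obtained by setting $z=0$, and $T_w^{*j}q(0,w)$ denotes the result of applying $T_w^{*j}$ to the function $q(0,\cdot)$, where on $H^2(\mathbb{T})$ the operator $T_w^*$ is the backward shift $\sum_{k\ge0}a_kw^k\mapsto\sum_{k\ge0}a_{k+1}w^k$. Functions on $\partial\mathbb{D}$ are boundary values, and identities between them are understood almost everywhere on $\partial\mathbb{D}$. *)

theory Defs
  imports "HOL-Analysis.Analysis"
begin

text \<open>
  Elements of the L2 spaces are represented by square integrable functions, not by equivalence
  classes modulo null sets. Closed subspaces are closed for the L2 seminorm, hence closed under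
  changing an element on a null set.
\<close>

definition L2 :: "'a measure \<Rightarrow> ('a \<Rightarrow> complex) set" where
  "L2 \<mu> = {f \<in> borel_measurable \<mu>. integrable \<mu> (\<lambda>x. (cmod (f x))\<^sup>2)}"

definition L2_inner :: "'a measure \<Rightarrow> ('a \<Rightarrow> complex) \<Rightarrow> ('a \<Rightarrow> complex) \<Rightarrow> complex" where
  "L2_inner \<mu> f g = (LINT x|\<mu>. f x * cnj (g x))"

definition L2_norm :: "'a measure \<Rightarrow> ('a \<Rightarrow> complex) \<Rightarrow> real" where
  "L2_norm \<mu> f = sqrt (LINT x|\<mu>. (cmod (f x))\<^sup>2)"

definition lin_span :: "('a \<Rightarrow> complex) set \<Rightarrow> ('a \<Rightarrow> complex) set" where
  "lin_span S = {\<lambda>x. \<Sum>s\<in>F. c s * s x | F c. finite F \<and> F \<subseteq> S}"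

definition L2_closure_in ::
    "'a measure \<Rightarrow> ('a \<Rightarrow> complex) set \<Rightarrow> ('a \<Rightarrow> complex) set \<Rightarrow> ('a \<Rightarrow> complex) set" where
  "L2_closure_in \<mu> V S = {f \<in> V. \<forall>\<epsilon>>0. \<exists>g\<in>S. L2_norm \<mu> (\<lambda>x. f x - g x) < \<epsilon>}"

definition closed_subspace :: "'a measure \<Rightarrow> ('a \<Rightarrow> complex) set \<Rightarrow> bool" where
  "closed_subspace \<mu> V \<longleftrightarrow>
     V \<subseteq> L2 \<mu> \<and>
     (\<lambda>x. 0) \<in> V \<and>
     (\<forall>f\<in>V. \<forall>g\<in>V. (\<lambda>x. f x + g x) \<in> V) \<and>
     (\<forall>c. \<forall>f\<in>V. (\<lambda>x. c * f x) \<in> V) \<and>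
     L2_closure_in \<mu> (L2 \<mu>) V \<subseteq> V"

text \<open>The orthogonal projection is determined up to a null set; a representative is chosen.\<close>

definition orth_proj ::
    "'a measure \<Rightarrow> ('a \<Rightarrow> complex) set \<Rightarrow> ('a \<Rightarrow> complex) \<Rightarrow> ('a \<Rightarrow> complex)" where
  "orth_proj \<mu> V f =
     (SOME g. g \<in> V \<and> (\<forall>h\<in>V. L2_inner \<mu> (\<lambda>x. f x - g x) h = 0))"

text \<open>
  Normalized arc length on the unit circle, as a measure on the complex plane that is
  concentrated on the circle.
\<close>

definition circle_measure :: "complex measure" where
  "circle_measure = distr (uniform_measure lborel {0..2 * pi}) borel cis"

definition torus_measure :: "(complex \<times> complex) measure" where
  "torus_measure = circle_measure \<Otimes>\<^sub>M circle_measure"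

definition fourier :: "(complex \<Rightarrow> complex) \<Rightarrow> int \<Rightarrow> complex" where
  "fourier f n = L2_inner circle_measure f (\<lambda>w. w powi n)"

definition hardy_circle :: "(complex \<Rightarrow> complex) set" where
  "hardy_circle = {f \<in> L2 circle_measure. \<forall>n<0. fourier f n = 0}"

text \<open>The Hilbert space tensor product of two copies of the Hardy space of the circle.\<close>

definition hardy_torus :: "(complex \<times> complex \<Rightarrow> complex) set" where
  "hardy_torus = L2_closure_in torus_measure (L2 torus_measure)
     (lin_span {\<lambda>(z, w). f z * g w | f g. f \<in> hardy_circle \<and> g \<in> hardy_circle})"

text \<open>
  The value at a point of the open unit disc of the holomorphic extension of a function in the
  Hardy space of the circle, by Cauchy's integral formula.
\<close>

definition hardy_value :: "(complex \<Rightarrow> complex) \<Rightarrow> complex \<Rightarrow> complex" where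
  "hardy_value f \<zeta> = (LINT z|circle_measure. f z / (1 - \<zeta> * cnj z))"

definition at_z_zero :: "(complex \<times> complex \<Rightarrow> complex) \<Rightarrow> (complex \<Rightarrow> complex)" where
  "at_z_zero q = (\<lambda>w. hardy_value (\<lambda>z. q (z, w)) 0)"

text \<open>
  The adjoint of multiplication by the coordinate function on the Hardy space of the circle, again
  as a chosen representative: the Fourier coefficients determine the result up to a null set.
\<close>

definition backward_shift :: "(complex \<Rightarrow> complex) \<Rightarrow> (complex \<Rightarrow> complex)" where
  "backward_shift f =
     (SOME g. g \<in> hardy_circle \<and> (\<forall>k::nat. fourier g (int k) = fourier f (int k + 1)))"

definition hom_poly :: "nat \<Rightarrow> complex \<times> complex \<Rightarrow> complex" where
  "hom_poly n = (\<lambda>(z, w). \<Sum>i\<le>n. z ^ i * w ^ (n - i))"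

definition \<H> :: "(complex \<times> complex \<Rightarrow> complex) set" where
  "\<H> = L2_closure_in torus_measure hardy_torus (lin_span (range hom_poly))"

definition T\<^sub>z :: "(complex \<times> complex \<Rightarrow> complex) \<Rightarrow> (complex \<times> complex \<Rightarrow> complex)" where
  "T\<^sub>z f = (\<lambda>(z, w). z * f (z, w))"

definition bergman_shift ::
    "(complex \<times> complex \<Rightarrow> complex) \<Rightarrow> (complex \<times> complex \<Rightarrow> complex)" where
  "bergman_shift f = orth_proj torus_measure \<H> (T\<^sub>z f)"

definition invariant_subspace :: "(complex \<times> complex \<Rightarrow> complex) set \<Rightarrow> bool" where
  "invariant_subspace M \<longleftrightarrow>
     closed_subspace torus_measure M \<and> M \<subseteq> \<H> \<and> bergman_shift ` M \<subseteq> M"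

definition wandering_subspace ::
    "(complex \<times> complex \<Rightarrow> complex) set \<Rightarrow> (complex \<times> complex \<Rightarrow> complex) set" where
  "wandering_subspace M =
     {q \<in> M. \<forall>g \<in> bergman_shift ` M. L2_inner torus_measure q g = 0}"

end

theory Submission
  imports Defs "HOL-Probability.Probability_Measure"
begin

text \<open>
  Write \<open>q = (\<Sum>n. a\<^sub>n * p\<^sub>n)\<close> for the homogeneous polynomials \<open>p\<^sub>n\<close>. They are orthogonal,
  \<open>p\<^sub>n\<close> has squared norm \<open>n + 1\<close>, and \<open>q(0, w) = (\<Sum>n. a\<^sub>n * w ^ n)\<close>, so the \<open>a\<^sub>n\<close> are also the
  Fourier coefficients of \<open>q(0, w)\<close>. The theorem holds because one sequence of numbers,
  \<open>s\<^sub>m = (\<Sum>n. (n + 1) * a\<^bsub>n + m\<^esub> * cnj a\<^sub>n)\<close>, appears in two places.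

  On the torus, \<open>s\<^sub>m\<close> is the inner product of \<open>q\<close> with \<open>B ^ m q\<close>: the Bergman shift moves the
  inner products with the \<open>p\<^sub>k\<close> by one place (\<open>bergman_shift_\<H>\<close>), so the weights \<open>n + m + 1\<close> cancel
  in Parseval's formula. Since \<open>B ^ m q\<close> lies in \<open>B M\<close> for \<open>m \<ge> 1\<close> and \<open>q\<close> is orthogonal to \<open>B M\<close>,
  all these numbers vanish.

  On the circle, \<open>s\<^sub>m\<close> is the \<open>m\<close>-th Fourier coefficient of the function
  \<open>S(w) = (\<Sum>j. |T\<^sub>w\<^sup>*\<^sup>j q(0, w)|\<^sup>2)\<close>: the \<open>j\<close>-th term contributes \<open>(\<Sum>k. a\<^bsub>j + k + m\<^esub> * cnj a\<^bsub>j + k\<^esub>)\<close>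
  (\<open>moment_hardy_circle\<close>), and in the sum over \<open>j\<close> the summand with \<open>j + k = n\<close> occurs \<open>n + 1\<close> times
  (\<open>sums_diagonals\<close>). Hence the real function \<open>S\<close> has no Fourier coefficient other than the zeroth
  one, and it is constant almost everywhere (\<open>backward_shift_orbit_constant\<close>).

  The finiteness of the norm of \<open>q\<close> yields only the integrability of \<open>S\<close>, so the last step needs the
  uniqueness of Fourier coefficients for integrable functions (\<open>null_moments_imp_AE_0\<close>), which rests on the
  Stone--Weierstrass theorem. The projection that defines the Bergman shift exists because \<open>L\<^sup>2\<close> is
  complete (\<open>L2_complete\<close>).
\<close>

section \<open>The space of square integrable functions\<close>

lemma borel_measurable_cnj [measurable (raw)]:
  "f \<in> borel_measurable \<mu> \<Longrightarrow> (\<lambda>x. cnj (f x)) \<in> borel_measurable \<mu>"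
  using measurable_compose[of f \<mu> borel cnj borel]
  by (simp add: borel_measurable_continuous_onI continuous_on_cnj)

lemma L2_measurable [measurable_dest]: "f \<in> L2 \<mu> \<Longrightarrow> f \<in> borel_measurable \<mu>"
  by (simp add: L2_def)

lemma L2_integrable_power2: "f \<in> L2 \<mu> \<Longrightarrow> integrable \<mu> (\<lambda>x. (cmod (f x))\<^sup>2)"
  by (simp add: L2_def)

lemma L2_dominatedI:
  assumes "f \<in> borel_measurable \<mu>" "integrable \<mu> g" "AE x in \<mu>. (cmod (f x))\<^sup>2 \<le> g x"
  shows "f \<in> L2 \<mu>"
proof -
  have "integrable \<mu> (\<lambda>x. (cmod (f x))\<^sup>2)"
    by (rule Bochner_Integration.integrable_bound[OF assms(2)]) (use assms in \<open>auto elim!: eventually_mono\<close>)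
  then show ?thesis using assms(1) by (simp add: L2_def)
qed

lemma L2_cmult:
  assumes "f \<in> L2 \<mu>"
  shows "(\<lambda>x. c * f x) \<in> L2 \<mu>"
  using assms by (auto simp: L2_def norm_mult power_mult_distrib)

lemma L2_add:
  assumes [measurable]: "f \<in> L2 \<mu>" "g \<in> L2 \<mu>"
  shows "(\<lambda>x. f x + g x) \<in> L2 \<mu>"
proof (rule L2_dominatedI)
  show "integrable \<mu> (\<lambda>x. 2 * (cmod (f x))\<^sup>2 + 2 * (cmod (g x))\<^sup>2)"
    using assms by (auto simp: L2_def)
  have "(cmod (a + b))\<^sup>2 \<le> 2 * (cmod a)\<^sup>2 + 2 * (cmod b)\<^sup>2" for a b
  proof -
    have "(cmod (a + b))\<^sup>2 \<le> (cmod a + cmod b)\<^sup>2"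
      by (intro power_mono norm_triangle_ineq) auto
    also have "\<dots> \<le> 2 * (cmod a)\<^sup>2 + 2 * (cmod b)\<^sup>2"
      using sum_squares_bound[of "cmod a" "cmod b"] by (simp add: power2_sum)
    finally show ?thesis .
  qed
  then show "AE x in \<mu>. (cmod (f x + g x))\<^sup>2 \<le> 2 * (cmod (f x))\<^sup>2 + 2 * (cmod (g x))\<^sup>2"
    by auto
qed measurable

lemma L2_diff:
  assumes "f \<in> L2 \<mu>" "g \<in> L2 \<mu>"
  shows "(\<lambda>x. f x - g x) \<in> L2 \<mu>"
  using L2_add[OF assms(1) L2_cmult[OF assms(2), of "-1"]] by simp

lemma L2_sum:
  assumes "finite I" "\<And>i. i \<in> I \<Longrightarrow> f i \<in> L2 \<mu>"
  shows "(\<lambda>x. \<Sum>i\<in>I. f i x) \<in> L2 \<mu>"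
  using assms
proof (induction I rule: finite_induct)
  case empty
  then show ?case by (simp add: L2_def)
next
  case (insert i I)
  then show ?case by (simp add: L2_add)
qed

lemma integrable_L2_inner:
  assumes [measurable]: "f \<in> L2 \<mu>" "g \<in> L2 \<mu>"
  shows "integrable \<mu> (\<lambda>x. f x * cnj (g x))"
proof (rule Bochner_Integration.integrable_bound)
  show "integrable \<mu> (\<lambda>x. (cmod (f x))\<^sup>2 + (cmod (g x))\<^sup>2)"
    using assms by (auto simp: L2_def)
  have "cmod (a * cnj b) \<le> (cmod a)\<^sup>2 + (cmod b)\<^sup>2" for a b
    using sum_squares_bound[of "cmod a" "cmod b"] mult_nonneg_nonneg[OF norm_ge_zero norm_ge_zero, of a b]
    unfolding norm_mult complex_mod_cnj by linarith
  then show "AE x in \<mu>. cmod (f x * cnj (g x)) \<le> norm ((cmod (f x))\<^sup>2 + (cmod (g x))\<^sup>2)"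
    by (auto intro!: AE_I2)
qed measurable

lemma L2_inner_cmult_left: "L2_inner \<mu> (\<lambda>x. c * f x) g = c * L2_inner \<mu> f g"
  by (simp add: L2_inner_def mult.assoc)

lemma L2_inner_diff_left:
  assumes "f \<in> L2 \<mu>" "g \<in> L2 \<mu>" "h \<in> L2 \<mu>"
  shows "L2_inner \<mu> (\<lambda>x. f x - g x) h = L2_inner \<mu> f h - L2_inner \<mu> g h"
  using assms by (simp add: L2_inner_def algebra_simps integrable_L2_inner)

lemma L2_inner_sum_left:
  assumes "\<And>i. i \<in> I \<Longrightarrow> f i \<in> L2 \<mu>" "h \<in> L2 \<mu>"
  shows "L2_inner \<mu> (\<lambda>x. \<Sum>i\<in>I. f i x) h = (\<Sum>i\<in>I. L2_inner \<mu> (f i) h)"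
  using assms by (simp add: L2_inner_def sum_distrib_right integrable_L2_inner)

lemma cnj_L2_inner: "cnj (L2_inner \<mu> f g) = L2_inner \<mu> g f"
  proof -
  have "cnj (L2_inner \<mu> f g) = (LINT x|\<mu>. cnj (f x * cnj (g x)))"
    unfolding L2_inner_def by (rule Bochner_Integration.integral_cnj[symmetric])
  then show ?thesis by (simp add: L2_inner_def mult.commute)
qed

lemma L2_inner_sum_right:
  assumes "\<And>i. i \<in> I \<Longrightarrow> f i \<in> L2 \<mu>" "h \<in> L2 \<mu>"
  shows "L2_inner \<mu> h (\<lambda>x. \<Sum>i\<in>I. f i x) = (\<Sum>i\<in>I. L2_inner \<mu> h (f i))"
proof -
  have "cnj (L2_inner \<mu> (\<lambda>x. \<Sum>i\<in>I. f i x) h) = (\<Sum>i\<in>I. cnj (L2_inner \<mu> (f i) h))"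
    using L2_inner_sum_left[of I f \<mu> h] assms by simp
  then show ?thesis by (simp only: cnj_L2_inner)
qed

lemma L2_norm_nonneg [simp]: "0 \<le> L2_norm \<mu> f"
  by (simp add: L2_norm_def)

lemma L2_norm_power2: "(L2_norm \<mu> f)\<^sup>2 = (LINT x|\<mu>. (cmod (f x))\<^sup>2)"
  by (simp add: L2_norm_def)

lemma L2_inner_self: "L2_inner \<mu> f f = of_real ((L2_norm \<mu> f)\<^sup>2)"
  unfolding L2_norm_power2 L2_inner_def integral_complex_of_real[symmetric]
  by (simp add: complex_norm_square del: of_real_power)

lemma L2_norm_minus_commute: "L2_norm \<mu> (\<lambda>x. f x - g x) = L2_norm \<mu> (\<lambda>x. g x - f x)"
  by (simp add: L2_norm_def norm_minus_commute)

lemma L2_norm_cmult: "L2_norm \<mu> (\<lambda>x. c * f x) = cmod c * L2_norm \<mu> f"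
  by (simp add: L2_norm_def norm_mult power_mult_distrib real_sqrt_mult)

lemma L2_norm_diff_power2:
  assumes "f \<in> L2 \<mu>" "g \<in> L2 \<mu>"
  shows "(L2_norm \<mu> (\<lambda>x. f x - g x))\<^sup>2 = (L2_norm \<mu> f)\<^sup>2 + (L2_norm \<mu> g)\<^sup>2 - 2 * Re (L2_inner \<mu> f g)"
proof -
  let ?d = "\<lambda>x. f x - g x"
  have d: "?d \<in> L2 \<mu>" using assms by (rule L2_diff)
  have "L2_inner \<mu> ?d ?d = L2_inner \<mu> f ?d - L2_inner \<mu> g ?d"
    by (rule L2_inner_diff_left) (use assms d in auto)
  also have "L2_inner \<mu> f ?d = cnj (L2_inner \<mu> f f - L2_inner \<mu> g f)"
    by (subst cnj_L2_inner[symmetric], subst L2_inner_diff_left) (use assms in auto)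
  also have "L2_inner \<mu> g ?d = cnj (L2_inner \<mu> f g - L2_inner \<mu> g g)"
    by (subst cnj_L2_inner[symmetric], subst L2_inner_diff_left) (use assms in auto)
  finally have eq: "L2_inner \<mu> ?d ?d = L2_inner \<mu> f f + L2_inner \<mu> g g
      - (L2_inner \<mu> f g + cnj (L2_inner \<mu> f g))"
    by (simp add: cnj_L2_inner)
  have "Re (L2_inner \<mu> ?d ?d) = Re (L2_inner \<mu> f f + L2_inner \<mu> g g
      - (L2_inner \<mu> f g + cnj (L2_inner \<mu> f g)))"
    by (simp only: eq)
  then show ?thesis
    unfolding L2_inner_self by simp
qed

text \<open>
  The squared norm of \<open>f - s * \<langle>f, g\<rangle> * g\<close> is a nonnegative quadratic polynomial in the real number
  \<open>s\<close>. Its value at \<open>s = 1 / \<parallel>g\<parallel>\<^sup>2\<close> is the inequality; if \<open>\<parallel>g\<parallel> = 0\<close>, the polynomial is linear and a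
  large \<open>s\<close> forces the inner product to vanish.
\<close>

lemma L2_Cauchy_Schwarz:
  assumes f: "f \<in> L2 \<mu>" and g: "g \<in> L2 \<mu>"
  shows "cmod (L2_inner \<mu> f g) \<le> L2_norm \<mu> f * L2_norm \<mu> g"
proof -
  define c where "c = L2_inner \<mu> f g"
  have *: "0 \<le> (L2_norm \<mu> f)\<^sup>2 + (s * cmod c)\<^sup>2 * (L2_norm \<mu> g)\<^sup>2 - 2 * s * (cmod c)\<^sup>2" for s :: real
  proof -
    have "L2_inner \<mu> f (\<lambda>x. (of_real s * c) * g x) = cnj (of_real s * c) * c"
      by (subst cnj_L2_inner[symmetric]) (simp add: L2_inner_cmult_left c_def cnj_L2_inner)
    also have "\<dots> = of_real (s * (cmod c)\<^sup>2)"
      using complex_norm_square[of c] by (simp add: mult_ac)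
    finally have "Re (L2_inner \<mu> f (\<lambda>x. (of_real s * c) * g x)) = s * (cmod c)\<^sup>2"
      by simp
    moreover have "(L2_norm \<mu> (\<lambda>x. (of_real s * c) * g x))\<^sup>2 = (s * cmod c)\<^sup>2 * (L2_norm \<mu> g)\<^sup>2"
      by (simp add: L2_norm_cmult norm_mult power_mult_distrib)
    ultimately show ?thesis
      using L2_norm_diff_power2[OF f L2_cmult[OF g, of "of_real s * c"]]
        zero_le_power2[of "L2_norm \<mu> (\<lambda>x. f x - (of_real s * c) * g x)"] by simp
  qed
  have "(cmod c)\<^sup>2 \<le> (L2_norm \<mu> f * L2_norm \<mu> g)\<^sup>2"
  proof (cases "L2_norm \<mu> g = 0")
    case True
    have "(cmod c)\<^sup>2 = 0"
    proof (rule ccontr)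
      assume "(cmod c)\<^sup>2 \<noteq> 0"
      then show False
        using *[of "((L2_norm \<mu> f)\<^sup>2 + 1) / (2 * (cmod c)\<^sup>2)"] True by simp
    qed
    then show ?thesis by simp
  next
    case False
    define b where "b = (L2_norm \<mu> g)\<^sup>2"
    have b: "b > 0" using False by (simp add: b_def)
    have "0 \<le> (L2_norm \<mu> f)\<^sup>2 + (1 / b * cmod c)\<^sup>2 * b - 2 * (1 / b) * (cmod c)\<^sup>2"
      using *[of "1 / b"] unfolding b_def .
    also have "\<dots> = (L2_norm \<mu> f)\<^sup>2 - (cmod c)\<^sup>2 / b"
      using b by (simp add: power2_eq_square field_simps)
    finally show ?thesis
      using b by (simp add: field_simps power_mult_distrib b_def)
  qed
  then show ?thesis
    unfolding c_def by (rule power2_le_imp_le) simp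
qed

lemma L2_inner_tendsto:
  assumes "\<And>n. s n \<in> L2 \<mu>" "f \<in> L2 \<mu>" "g \<in> L2 \<mu>"
    and lim: "(\<lambda>n. L2_norm \<mu> (\<lambda>x. f x - s n x)) \<longlonglongrightarrow> 0"
  shows "(\<lambda>n. L2_inner \<mu> (s n) g) \<longlonglongrightarrow> L2_inner \<mu> f g"
proof -
  have "(\<lambda>n. L2_inner \<mu> f g - L2_inner \<mu> (s n) g) \<longlonglongrightarrow> 0"
  proof (rule Lim_null_comparison)
    show "(\<lambda>n. L2_norm \<mu> (\<lambda>x. f x - s n x) * L2_norm \<mu> g) \<longlonglongrightarrow> 0"
      using tendsto_mult[OF lim tendsto_const[of "L2_norm \<mu> g"]] by simp
    show "\<forall>\<^sub>F n in sequentially. cmod (L2_inner \<mu> f g - L2_inner \<mu> (s n) g)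
        \<le> L2_norm \<mu> (\<lambda>x. f x - s n x) * L2_norm \<mu> g"
      using assms L2_Cauchy_Schwarz[OF L2_diff[OF assms(2,1)] assms(3)]
      by (simp add: L2_inner_diff_left)
  qed
  from tendsto_diff[OF tendsto_const[of "L2_inner \<mu> f g"] this] show ?thesis by simp
qed

lemma L2_norm_eq_0_imp_AE:
  assumes f: "f \<in> L2 \<mu>" and "L2_norm \<mu> f = 0"
  shows "AE x in \<mu>. f x = 0"
proof -
  have "(LINT x|\<mu>. (cmod (f x))\<^sup>2) = 0"
    using assms(2) L2_norm_power2[of \<mu> f] by simp
  then have "AE x in \<mu>. (cmod (f x))\<^sup>2 = 0"
    by (subst (asm) integral_nonneg_eq_0_iff_AE) (use L2_integrable_power2[OF f] in auto)
  then show ?thesis by simp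
qed

lemma (in finite_measure) L2_const: "(\<lambda>x. c) \<in> L2 M"
  by (simp add: L2_def)

lemma (in finite_measure) L2_bounded:
  assumes "f \<in> borel_measurable M" "AE x in M. cmod (f x) \<le> b"
  shows "f \<in> L2 M"
proof (rule L2_dominatedI)
  show "integrable M (\<lambda>x. b\<^sup>2)" by simp
  show "AE x in M. (cmod (f x))\<^sup>2 \<le> b\<^sup>2"
    using assms(2) by (auto elim!: eventually_mono intro: power_mono)
qed fact

lemma (in finite_measure) L2_integrable:
  assumes f: "f \<in> L2 M"
  shows "integrable M f"
  using integrable_L2_inner[OF f L2_const[of 1]] by simp

lemma (in finite_measure) integral_cmod_le_L2_norm:
  assumes f: "f \<in> L2 M"
  shows "(LINT x|M. cmod (f x)) \<le> L2_norm M f * sqrt (measure M (space M))"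
proof -
  have F: "(\<lambda>x. complex_of_real (cmod (f x))) \<in> L2 M"
    using f by (auto simp: L2_def)
  have "L2_inner M (\<lambda>x. complex_of_real (cmod (f x))) (\<lambda>x. 1) = of_real (LINT x|M. cmod (f x))"
    by (simp add: L2_inner_def)
  then have "\<bar>LINT x|M. cmod (f x)\<bar> \<le> L2_norm M (\<lambda>x. complex_of_real (cmod (f x))) * L2_norm M (\<lambda>x. 1)"
    using L2_Cauchy_Schwarz[OF F L2_const[of 1]] by (simp del: integral_complex_of_real)
  also have "\<dots> = L2_norm M f * sqrt (measure M (space M))"
    by (simp add: L2_norm_def)
  finally show ?thesis by linarith
qed

text \<open>
  On a space of finite measure a Cauchy sequence in \<open>L\<^sup>2\<close> is also Cauchy in \<open>L\<^sup>1\<close>, so that a subsequence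
  converges almost everywhere. Fatou's lemma shows that the pointwise limit is the limit in \<open>L\<^sup>2\<close>.
\<close>

lemma (in finite_measure) L2_complete:
  assumes s: "\<And>n. s n \<in> L2 M"
    and Cauchy: "\<And>\<epsilon>. \<epsilon> > 0 \<Longrightarrow> \<exists>N. \<forall>i\<ge>N. \<forall>j\<ge>N. L2_norm M (\<lambda>x. s i x - s j x) < \<epsilon>"
  obtains g where "g \<in> L2 M" "(\<lambda>n. L2_norm M (\<lambda>x. g x - s n x)) \<longlonglongrightarrow> 0"
proof -
  have [measurable]: "\<And>n. s n \<in> borel_measurable M" using s by measurable
  obtain r :: "nat \<Rightarrow> nat" where r: "strict_mono r" and ae: "AE x in M. Cauchy (\<lambda>i. s (r i) x)"
  proof (rule cauchy_L1_AE_cauchy_subseq[of M s])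
    show "integrable M (s n)" for n using s by (rule L2_integrable)
    fix e :: real assume e: "e > 0"
    \<comment> \<open>The summand 1 keeps the denominator positive when the measure is zero.\<close>
    define C where "C = sqrt (measure M (space M)) + 1"
    have C: "C > 0" unfolding C_def by (intro add_nonneg_pos) auto
    obtain N where N: "\<forall>i\<ge>N. \<forall>j\<ge>N. L2_norm M (\<lambda>x. s i x - s j x) < e / C"
      using Cauchy[of "e / C"] e C by auto
    have "(LINT x|M. cmod (s i x - s j x)) < e" if "i \<ge> N" "j \<ge> N" for i j
    proof -
      have "(LINT x|M. cmod (s i x - s j x)) \<le> L2_norm M (\<lambda>x. s i x - s j x) * sqrt (measure M (space M))"
        using s by (intro integral_cmod_le_L2_norm L2_diff)
      also have "\<dots> \<le> L2_norm M (\<lambda>x. s i x - s j x) * C"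
        by (intro mult_left_mono) (auto simp: C_def)
      also have "\<dots> < e / C * C"
        using N that C by (intro mult_strict_right_mono) auto
      finally show ?thesis using C by simp
    qed
    then show "\<exists>N. \<forall>i\<ge>N. \<forall>j\<ge>N. (LINT x|M. norm (s i x - s j x)) < e" by blast
  qed auto
  define g where "g x = lim (\<lambda>i. s (r i) x)" for x
  have [measurable]: "g \<in> borel_measurable M" unfolding g_def by measurable
  have lim: "AE x in M. (\<lambda>i. s (r i) x) \<longlonglongrightarrow> g x"
    using ae unfolding g_def by (auto elim!: eventually_mono simp: Cauchy_convergent_iff convergent_LIMSEQ_iff)
  have bound: "(\<integral>\<^sup>+x. ennreal ((cmod (g x - s n x))\<^sup>2) \<partial>M) \<le> ennreal (\<epsilon>\<^sup>2)"
    if N: "\<forall>i\<ge>N. \<forall>j\<ge>N. L2_norm M (\<lambda>x. s i x - s j x) < \<epsilon>" and n: "n \<ge> N" for n N \<epsilon>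
  proof -
    have "(\<integral>\<^sup>+x. ennreal ((cmod (g x - s n x))\<^sup>2) \<partial>M)
        = (\<integral>\<^sup>+x. liminf (\<lambda>i. ennreal ((cmod (s (r i) x - s n x))\<^sup>2)) \<partial>M)"
    proof (rule nn_integral_cong_AE, use lim in eventually_elim)
      fix x assume "(\<lambda>i. s (r i) x) \<longlonglongrightarrow> g x"
      then have "(\<lambda>i. ennreal ((cmod (s (r i) x - s n x))\<^sup>2)) \<longlonglongrightarrow> ennreal ((cmod (g x - s n x))\<^sup>2)"
        by (intro tendsto_intros tendsto_ennrealI)
      then show "ennreal ((cmod (g x - s n x))\<^sup>2) = liminf (\<lambda>i. ennreal ((cmod (s (r i) x - s n x))\<^sup>2))"
        by (metis lim_imp_Liminf trivial_limit_sequentially)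
    qed
    also have "\<dots> \<le> liminf (\<lambda>i. \<integral>\<^sup>+x. ennreal ((cmod (s (r i) x - s n x))\<^sup>2) \<partial>M)"
      by (rule nn_integral_liminf) measurable
    also have "\<dots> \<le> liminf (\<lambda>i::nat. ennreal (\<epsilon>\<^sup>2))"
    proof (rule Liminf_mono)
      show "\<forall>\<^sub>F i in sequentially. (\<integral>\<^sup>+x. ennreal ((cmod (s (r i) x - s n x))\<^sup>2) \<partial>M) \<le> ennreal (\<epsilon>\<^sup>2)"
        using eventually_ge_at_top[of N]
      proof eventually_elim
        fix i assume "N \<le> i"
        then have "r i \<ge> N" using seq_suble[OF r, of i] by simp
        then have "(L2_norm M (\<lambda>x. s (r i) x - s n x))\<^sup>2 \<le> \<epsilon>\<^sup>2"
          using N n by (intro power_mono) (auto simp: less_imp_le)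
        moreover have "(\<integral>\<^sup>+x. ennreal ((cmod (s (r i) x - s n x))\<^sup>2) \<partial>M)
            = ennreal ((L2_norm M (\<lambda>x. s (r i) x - s n x))\<^sup>2)"
          unfolding L2_norm_power2
          by (rule nn_integral_eq_integral) (use L2_integrable_power2[OF L2_diff[OF s s]] in auto)
        ultimately show "(\<integral>\<^sup>+x. ennreal ((cmod (s (r i) x - s n x))\<^sup>2) \<partial>M) \<le> ennreal (\<epsilon>\<^sup>2)"
          by (simp add: ennreal_leI)
      qed
    qed
    also have "\<dots> = ennreal (\<epsilon>\<^sup>2)" by (simp add: Liminf_const)
    finally show ?thesis .
  qed
  have diff: "(\<lambda>x. g x - s n x) \<in> L2 M \<and> L2_norm M (\<lambda>x. g x - s n x) \<le> \<epsilon>"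
    if "\<forall>i\<ge>N. \<forall>j\<ge>N. L2_norm M (\<lambda>x. s i x - s j x) < \<epsilon>" "n \<ge> N" "\<epsilon> > 0" for n N \<epsilon>
  proof
    note b = bound[OF that(1,2)]
    have "integrable M (\<lambda>x. (cmod (g x - s n x))\<^sup>2)"
    proof (rule integrableI_bounded)
      show "(\<integral>\<^sup>+x. ennreal (norm ((cmod (g x - s n x))\<^sup>2)) \<partial>M) < \<infinity>"
        using le_less_trans[OF b ennreal_less_top] by simp
    qed measurable
    then show mem: "(\<lambda>x. g x - s n x) \<in> L2 M" by (simp add: L2_def)
    have "(\<integral>\<^sup>+x. ennreal ((cmod (g x - s n x))\<^sup>2) \<partial>M) = ennreal ((L2_norm M (\<lambda>x. g x - s n x))\<^sup>2)"
      unfolding L2_norm_power2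
      by (rule nn_integral_eq_integral[OF L2_integrable_power2[OF mem]]) simp
    from b[unfolded this] have "(L2_norm M (\<lambda>x. g x - s n x))\<^sup>2 \<le> \<epsilon>\<^sup>2"
      by (subst (asm) ennreal_le_iff) auto
    then show "L2_norm M (\<lambda>x. g x - s n x) \<le> \<epsilon>"
      using less_imp_le[OF that(3)] by (rule power2_le_imp_le)
  qed
  have gL2: "g \<in> L2 M"
  proof -
    obtain N where N: "\<forall>i\<ge>N. \<forall>j\<ge>N. L2_norm M (\<lambda>x. s i x - s j x) < 1"
      using Cauchy[of 1] by auto
    have "(\<lambda>x. (g x - s N x) + s N x) \<in> L2 M"
      by (rule L2_add[OF conjunct1[OF diff[OF N order_refl zero_less_one]] s])
    then show ?thesis by simp
  qed
  have "(\<lambda>n. L2_norm M (\<lambda>x. g x - s n x)) \<longlonglongrightarrow> 0"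
  proof (rule LIMSEQ_I)
    fix e :: real assume e: "e > 0"
    obtain N where N: "\<forall>i\<ge>N. \<forall>j\<ge>N. L2_norm M (\<lambda>x. s i x - s j x) < e / 2"
      using Cauchy[of "e / 2"] e by auto
    have "norm (L2_norm M (\<lambda>x. g x - s n x) - 0) < e" if "n \<ge> N" for n
      using conjunct2[OF diff[OF N that half_gt_zero[OF e]]] e by simp
    then show "\<exists>no. \<forall>n\<ge>no. norm (L2_norm M (\<lambda>x. g x - s n x) - 0) < e" by blast
  qed
  with gL2 show thesis by (rule that)
qed

text \<open>
  The linear span is defined by sums over sets of functions. For a family that is not injective,
  the coefficients of equal members have to be collected.
\<close>

lemma lin_span_sum:
  assumes "finite I" "\<And>i. i \<in> I \<Longrightarrow> f i \<in> S"
  shows "(\<lambda>x. \<Sum>i\<in>I. c i * f i x) \<in> lin_span S"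
proof -
  have "(\<lambda>x. \<Sum>i\<in>I. c i * f i x) = (\<lambda>x. \<Sum>s\<in>f ` I. (\<Sum>i\<in>{i\<in>I. f i = s}. c i) * s x)"
  proof
    fix x
    have "(\<Sum>s\<in>f ` I. (\<Sum>i\<in>{i\<in>I. f i = s}. c i) * s x) = (\<Sum>s\<in>f ` I. \<Sum>i\<in>{i\<in>I. f i = s}. c i * f i x)"
      by (simp add: sum_distrib_right)
    then show "(\<Sum>i\<in>I. c i * f i x) = (\<Sum>s\<in>f ` I. (\<Sum>i\<in>{i\<in>I. f i = s}. c i) * s x)"
      using sum.image_gen[OF assms(1), of "\<lambda>i. c i * f i x" f] by simp
  qed
  then show ?thesis
    unfolding lin_span_def using assms
    by (intro CollectI exI[of _ "f ` I"] exI[of _ "\<lambda>s. \<Sum>i\<in>{i\<in>I. f i = s}. c i"]) auto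
qed

text \<open>
  For \<open>t\<close> in the span close to \<open>h\<close>, the inner product of \<open>v\<close> with \<open>h\<close> equals that with \<open>h - t\<close>, which
  is small by the Cauchy--Schwarz inequality.
\<close>

lemma L2_inner_closure_span_eq_0:
  assumes v: "v \<in> L2 \<mu>" and S: "S \<subseteq> L2 \<mu>" and V: "V \<subseteq> L2 \<mu>"
    and orth: "\<And>s. s \<in> S \<Longrightarrow> L2_inner \<mu> v s = 0"
    and h: "h \<in> L2_closure_in \<mu> V (lin_span S)"
  shows "L2_inner \<mu> v h = 0"
proof -
  have hL2: "h \<in> L2 \<mu>" using h V by (auto simp: L2_closure_in_def)
  have "cmod (L2_inner \<mu> v h) \<le> \<epsilon> * L2_norm \<mu> v" if "\<epsilon> > 0" for \<epsilon>
  proof -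
    obtain t where t: "t \<in> lin_span S" "L2_norm \<mu> (\<lambda>x. h x - t x) < \<epsilon>"
      using h \<open>\<epsilon> > 0\<close> by (auto simp: L2_closure_in_def)
    obtain F c where F: "finite F" "F \<subseteq> S" "t = (\<lambda>x. \<Sum>s\<in>F. c s * s x)"
      using t(1) by (auto simp: lin_span_def)
    have FL2: "s \<in> F \<Longrightarrow> (\<lambda>x. c s * s x) \<in> L2 \<mu>" for s
      using F S by (intro L2_cmult) auto
    have tL2: "t \<in> L2 \<mu>"
      unfolding F(3) using F FL2 by (intro L2_sum)
    have "L2_inner \<mu> t v = 0"
    proof -
      have "L2_inner \<mu> s v = 0" if "s \<in> F" for s
        using orth[of s] that F(2) cnj_L2_inner[of \<mu> v s] by auto
      then show ?thesis
        unfolding F(3) using FL2 v by (subst L2_inner_sum_left) (auto simp: L2_inner_cmult_left)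
    qed
    then have "L2_inner \<mu> h v = L2_inner \<mu> (\<lambda>x. h x - t x) v"
      using L2_inner_diff_left[OF hL2 tL2 v] by simp
    then have "cmod (L2_inner \<mu> h v) \<le> L2_norm \<mu> (\<lambda>x. h x - t x) * L2_norm \<mu> v"
      using L2_Cauchy_Schwarz[OF L2_diff[OF hL2 tL2] v] by simp
    also have "\<dots> \<le> \<epsilon> * L2_norm \<mu> v"
      using t(2) by (intro mult_right_mono) auto
    finally show ?thesis
      by (metis cnj_L2_inner complex_mod_cnj)
  qed
  note * = this
  have "cmod (L2_inner \<mu> v h) \<le> 0 + e" if "e > 0" for e
  proof -
    have "cmod (L2_inner \<mu> v h) \<le> (e / (L2_norm \<mu> v + 1)) * L2_norm \<mu> v"
      using that by (intro * divide_pos_pos add_nonneg_pos) auto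
    also have "\<dots> \<le> e"
      using that add_nonneg_pos[OF L2_norm_nonneg[of \<mu> v] zero_less_one]
      by (simp add: divide_le_eq algebra_simps)
    finally show ?thesis by simp
  qed
  then have "cmod (L2_inner \<mu> v h) \<le> 0" by (rule field_le_epsilon)
  then show ?thesis by simp
qed

section \<open>Orthogonal sequences and their closed spans\<close>

text \<open>
  The powers of \<open>w\<close> on the circle and the homogeneous polynomials on the torus are two instances,
  with \<open>\<nu> n\<close> equal to \<open>1\<close> and to \<open>n + 1\<close>.
\<close>

locale orthogonal_sequence = finite_measure \<mu> for \<mu> :: "'a measure" +
  fixes e :: "nat \<Rightarrow> 'a \<Rightarrow> complex" and \<nu> :: "nat \<Rightarrow> real"
  assumes L2_e: "e n \<in> L2 \<mu>"
    and inner_e: "L2_inner \<mu> (e m) (e n) = (if m = n then of_real (\<nu> n) else 0)"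
    and \<nu>_pos: "\<nu> n > 0"
begin

definition coef :: "('a \<Rightarrow> complex) \<Rightarrow> nat \<Rightarrow> complex" where
  "coef u n = L2_inner \<mu> u (e n) / of_real (\<nu> n)"

definition psum :: "('a \<Rightarrow> complex) \<Rightarrow> nat \<Rightarrow> 'a \<Rightarrow> complex" where
  "psum u N = (\<lambda>x. \<Sum>n<N. coef u n * e n x)"

lemma L2_comb: "finite I \<Longrightarrow> (\<lambda>x. \<Sum>n\<in>I. c n * e n x) \<in> L2 \<mu>"
  by (intro L2_sum L2_cmult L2_e)

lemma L2_psum: "psum u N \<in> L2 \<mu>"
  unfolding psum_def by (intro L2_comb) auto

lemma inner_comb_e:
  assumes "finite I"
  shows "L2_inner \<mu> (\<lambda>x. \<Sum>n\<in>I. c n * e n x) (e k) = (if k \<in> I then c k * of_real (\<nu> k) else 0)"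
proof -
  have "L2_inner \<mu> (\<lambda>x. \<Sum>n\<in>I. c n * e n x) (e k) = (\<Sum>n\<in>I. c n * (if n = k then of_real (\<nu> k) else 0))"
    by (subst L2_inner_sum_left) (auto simp: L2_inner_cmult_left inner_e L2_e L2_cmult)
  also have "\<dots> = (\<Sum>n\<in>I. if n = k then c k * of_real (\<nu> k) else 0)"
    by (intro sum.cong) auto
  finally show ?thesis using assms by simp
qed

lemma norm_comb_power2:
  assumes "finite I"
  shows "(L2_norm \<mu> (\<lambda>x. \<Sum>n\<in>I. c n * e n x))\<^sup>2 = (\<Sum>n\<in>I. (cmod (c n))\<^sup>2 * \<nu> n)"
proof -
  let ?t = "\<lambda>x. \<Sum>n\<in>I. c n * e n x"
  have "L2_inner \<mu> ?t ?t = (\<Sum>n\<in>I. c n * L2_inner \<mu> (e n) ?t)"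
    by (subst L2_inner_sum_left) (auto simp: L2_inner_cmult_left L2_comb assms L2_e L2_cmult)
  also have "\<dots> = (\<Sum>n\<in>I. c n * cnj (c n) * of_real (\<nu> n))"
    using inner_comb_e[OF assms, of c]
    by (intro sum.cong) (auto simp flip: cnj_L2_inner[of \<mu> ?t])
  also have "\<dots> = of_real (\<Sum>n\<in>I. (cmod (c n))\<^sup>2 * \<nu> n)"
    by (simp add: complex_norm_square del: of_real_power)
  finally show ?thesis
    unfolding L2_inner_self of_real_eq_iff .
qed

lemma inner_diff_psum_e:
  assumes "u \<in> L2 \<mu>" "k < N"
  shows "L2_inner \<mu> (\<lambda>x. u x - psum u N x) (e k) = 0"
  using assms inner_comb_e[of "{..<N}" "coef u" k] \<nu>_pos[of k]
  by (simp add: L2_inner_diff_left L2_psum L2_e) (simp add: psum_def coef_def)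

lemma Bessel:
  assumes u: "u \<in> L2 \<mu>"
  shows "(\<Sum>n<N. (cmod (coef u n))\<^sup>2 * \<nu> n) \<le> (L2_norm \<mu> u)\<^sup>2"
proof -
  let ?d = "\<lambda>x. u x - psum u N x"
  have d: "?d \<in> L2 \<mu>" using u L2_psum by (rule L2_diff)
  have "L2_inner \<mu> (\<lambda>x. \<Sum>n<N. coef u n * e n x) ?d = (\<Sum>n<N. coef u n * L2_inner \<mu> (e n) ?d)"
    using d by (subst L2_inner_sum_left) (auto simp: L2_e L2_cmult L2_inner_cmult_left)
  also have "\<dots> = 0"
    using inner_diff_psum_e[OF u, of _ N] by (intro sum.neutral) (auto simp flip: cnj_L2_inner[of \<mu> ?d])
  finally have 0: "L2_inner \<mu> (psum u N) ?d = 0"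
    by (simp add: psum_def)
  have "L2_inner \<mu> ?d (psum u N) = 0"
    using 0 cnj_L2_inner[of \<mu> "psum u N" ?d] by simp
  then have "L2_inner \<mu> u (psum u N) = of_real ((L2_norm \<mu> (psum u N))\<^sup>2)"
    using L2_inner_diff_left[OF u L2_psum L2_psum, of u N u N] L2_inner_self[of \<mu> "psum u N"] by simp
  then have "(L2_norm \<mu> ?d)\<^sup>2 = (L2_norm \<mu> u)\<^sup>2 - (L2_norm \<mu> (psum u N))\<^sup>2"
    using L2_norm_diff_power2[OF u L2_psum, of u N] by (simp del: of_real_power)
  then have "(L2_norm \<mu> (psum u N))\<^sup>2 \<le> (L2_norm \<mu> u)\<^sup>2"
    using zero_le_power2[of "L2_norm \<mu> ?d"] by linarith
  then show ?thesis
    unfolding psum_def by (subst (asm) norm_comb_power2) auto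
qed

lemma summable_coef:
  assumes "u \<in> L2 \<mu>"
  shows "summable (\<lambda>n. (cmod (coef u n))\<^sup>2 * \<nu> n)"
proof (rule summableI_nonneg_bounded)
  show "0 \<le> (cmod (coef u n))\<^sup>2 * \<nu> n" for n
    using \<nu>_pos[of n] by simp
  show "(\<Sum>n<N. (cmod (coef u n))\<^sup>2 * \<nu> n) \<le> (L2_norm \<mu> u)\<^sup>2" for N
    using assms by (rule Bessel)
qed

lemma norm_psum_diff_power2:
  assumes "m \<le> n"
  shows "(L2_norm \<mu> (\<lambda>x. psum u n x - psum u m x))\<^sup>2 = (\<Sum>k\<in>{m..<n}. (cmod (coef u k))\<^sup>2 * \<nu> k)"
proof -
  have "psum u n x - psum u m x = (\<Sum>k\<in>{m..<n}. coef u k * e k x)" for x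
    unfolding psum_def using sum_diff_nat_ivl[of 0 m n "\<lambda>k. coef u k * e k x"] assms
    by (simp add: lessThan_atLeast0)
  then show ?thesis by (simp add: norm_comb_power2)
qed

text \<open>
  Bessel's inequality makes the partial sums of the Fourier expansion a Cauchy sequence. Its limit
  is the orthogonal projection of \<open>u\<close> onto the closed span of the sequence.
\<close>

lemma projection_exists:
  assumes u: "u \<in> L2 \<mu>"
  obtains g where "g \<in> L2 \<mu>" "(\<lambda>N. L2_norm \<mu> (\<lambda>x. g x - psum u N x)) \<longlonglongrightarrow> 0"
    "\<And>k. L2_inner \<mu> (\<lambda>x. u x - g x) (e k) = 0"
proof -
  obtain g where g: "g \<in> L2 \<mu>" and lim: "(\<lambda>N. L2_norm \<mu> (\<lambda>x. g x - psum u N x)) \<longlonglongrightarrow> 0"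
  proof (rule L2_complete[of "psum u"])
    fix \<epsilon> :: real assume e: "\<epsilon> > 0"
    obtain N where N: "\<And>m n. m \<ge> N \<Longrightarrow> norm (\<Sum>k\<in>{m..<n}. (cmod (coef u k))\<^sup>2 * \<nu> k) < \<epsilon>\<^sup>2"
      using summable_coef[OF u] e unfolding summable_Cauchy by (metis zero_less_power)
    have 1: "L2_norm \<mu> (\<lambda>x. psum u n x - psum u m x) < \<epsilon>" if "m \<ge> N" "m \<le> n" for m n
      using N[OF that(1), of n] norm_psum_diff_power2[OF that(2), of u] e
      by (intro power2_less_imp_less[of _ \<epsilon>]) auto
    have "L2_norm \<mu> (\<lambda>x. psum u i x - psum u j x) < \<epsilon>" if "i \<ge> N" "j \<ge> N" for i j
      using 1[of i j] 1[of j i] that L2_norm_minus_commute[of \<mu> "psum u i" "psum u j"]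
      by (cases "i \<le> j") auto
    then show "\<exists>N. \<forall>i\<ge>N. \<forall>j\<ge>N. L2_norm \<mu> (\<lambda>x. psum u i x - psum u j x) < \<epsilon>" by blast
  qed (auto simp: L2_psum)
  have "L2_inner \<mu> (\<lambda>x. u x - g x) (e k) = 0" for k
  proof -
    have "(\<lambda>N. L2_inner \<mu> (psum u N) (e k)) \<longlonglongrightarrow> L2_inner \<mu> g (e k)"
      by (rule L2_inner_tendsto) (use g lim L2_e L2_psum in auto)
    moreover have "\<forall>\<^sub>F N in sequentially. L2_inner \<mu> (psum u N) (e k) = L2_inner \<mu> u (e k)"
      using eventually_gt_at_top[of k]
    proof eventually_elim
      fix N assume "k < N"
      then show "L2_inner \<mu> (psum u N) (e k) = L2_inner \<mu> u (e k)"
        using inner_diff_psum_e[OF u, of k N] L2_inner_diff_left[OF u L2_psum L2_e, of u N k] by simp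
    qed
    ultimately have "L2_inner \<mu> g (e k) = L2_inner \<mu> u (e k)"
      using tendsto_eventually LIMSEQ_unique by metis
    then show ?thesis using u g L2_e by (simp add: L2_inner_diff_left)
  qed
  with g lim show thesis by (rule that)
qed

lemma psum_in_lin_span: "psum u N \<in> lin_span (range e)"
  unfolding psum_def by (rule lin_span_sum) auto

text \<open>
  Both \<open>u\<close> and its projection \<open>g\<close> lie in the closed span, and \<open>u - g\<close> is orthogonal to it. Hence
  \<open>u - g\<close> is orthogonal to itself and vanishes almost everywhere.
\<close>

lemma psum_tendsto_closure:
  assumes u: "u \<in> L2_closure_in \<mu> (L2 \<mu>) (lin_span (range e))"
  shows "(\<lambda>N. L2_norm \<mu> (\<lambda>x. u x - psum u N x)) \<longlonglongrightarrow> 0"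
proof -
  have uL2: "u \<in> L2 \<mu>" using u by (simp add: L2_closure_in_def)
  obtain g where g: "g \<in> L2 \<mu>" and lim: "(\<lambda>N. L2_norm \<mu> (\<lambda>x. g x - psum u N x)) \<longlonglongrightarrow> 0"
    and orth: "\<And>k. L2_inner \<mu> (\<lambda>x. u x - g x) (e k) = 0"
    by (rule projection_exists[OF uL2], rule that)
  have d: "(\<lambda>x. u x - g x) \<in> L2 \<mu>" using uL2 g by (rule L2_diff)
  have gcl: "g \<in> L2_closure_in \<mu> (L2 \<mu>) (lin_span (range e))"
    unfolding L2_closure_in_def
  proof (intro CollectI conjI g allI impI)
    fix \<epsilon> :: real assume "\<epsilon> > 0"
    then have "\<forall>\<^sub>F N in sequentially. L2_norm \<mu> (\<lambda>x. g x - psum u N x) < \<epsilon>"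
      by (rule order_tendstoD(2)[OF lim])
    then show "\<exists>h\<in>lin_span (range e). L2_norm \<mu> (\<lambda>x. g x - h x) < \<epsilon>"
      using psum_in_lin_span by (auto simp: eventually_sequentially)
  qed
  have 0: "L2_inner \<mu> (\<lambda>x. u x - g x) h = 0" if "h \<in> L2_closure_in \<mu> (L2 \<mu>) (lin_span (range e))" for h
    by (rule L2_inner_closure_span_eq_0[OF d _ _ _ that]) (use L2_e orth in auto)
  have "L2_inner \<mu> u (\<lambda>x. u x - g x) - L2_inner \<mu> g (\<lambda>x. u x - g x) = 0"
    using arg_cong[OF 0[OF u], of cnj] arg_cong[OF 0[OF gcl], of cnj] by (simp add: cnj_L2_inner)
  then have "L2_norm \<mu> (\<lambda>x. u x - g x) = 0"
    using L2_inner_diff_left[OF uL2 g d] L2_inner_self[of \<mu> "\<lambda>x. u x - g x"] by simp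
  with d have ae: "AE x in \<mu>. u x - g x = 0" by (rule L2_norm_eq_0_imp_AE)
  have "L2_norm \<mu> (\<lambda>x. u x - psum u N x) = L2_norm \<mu> (\<lambda>x. g x - psum u N x)" for N
  proof -
    have [measurable]: "u \<in> borel_measurable \<mu>" "g \<in> borel_measurable \<mu>" "psum u N \<in> borel_measurable \<mu>"
      using uL2 g L2_psum[of u N] by (auto simp: L2_def)
    have "AE x in \<mu>. (cmod (u x - psum u N x))\<^sup>2 = (cmod (g x - psum u N x))\<^sup>2"
      using ae by eventually_elim simp
    then show ?thesis
      unfolding L2_norm_def by (intro arg_cong[of _ _ sqrt] integral_cong_AE) measurable
  qed
  with lim show ?thesis by simp
qed

text \<open>
  Continuity of the inner product in its first argument. Later \<open>v\<close> is often outside the closed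
  span, for instance a monomial on the torus, so only \<open>u\<close> is expanded.
\<close>

lemma Parseval:
  assumes u: "u \<in> L2 \<mu>" and lim: "(\<lambda>N. L2_norm \<mu> (\<lambda>x. u x - psum u N x)) \<longlonglongrightarrow> 0"
    and v: "v \<in> L2 \<mu>"
  shows "(\<lambda>n. coef u n * L2_inner \<mu> (e n) v) sums L2_inner \<mu> u v"
proof -
  have "(\<lambda>N. L2_inner \<mu> (psum u N) v) \<longlonglongrightarrow> L2_inner \<mu> u v"
    by (rule L2_inner_tendsto) (use u v lim L2_psum in auto)
  moreover have "L2_inner \<mu> (psum u N) v = (\<Sum>n<N. coef u n * L2_inner \<mu> (e n) v)" for N
    unfolding psum_def using v
    by (subst L2_inner_sum_left) (auto simp: L2_e L2_cmult L2_inner_cmult_left)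
  ultimately show ?thesis by (simp add: sums_def)
qed

end

section \<open>Integrable functions on the circle are determined by their moments\<close>

lemma borel_measurable_cis [measurable]: "cis \<in> borel_measurable borel"
  by (intro borel_measurable_continuous_onI continuous_intros)

lemma sets_circle_measure [simp, measurable_cong]: "sets circle_measure = sets borel"
  by (simp add: circle_measure_def)

lemma space_circle_measure [simp]: "space circle_measure = UNIV"
  by (simp add: circle_measure_def)

lemma borel_measurable_circle [simp]: "borel_measurable circle_measure = borel_measurable borel"
  by (rule measurable_cong_sets) simp_all

lemma prob_space_circle_measure: "prob_space circle_measure"
proof -
  interpret U: prob_space "uniform_measure lborel {0..2 * pi}"
    by (rule prob_space_uniform_measure) auto
  show ?thesis
    unfolding circle_measure_def by (rule U.prob_space_distr) measurable
qed

interpretation circle: prob_space circle_measure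
  by (rule prob_space_circle_measure)

lemma AE_circle_cmod: "AE w in circle_measure. cmod w = 1"
proof -
  have "{w \<in> space borel. cmod w = 1} \<in> sets borel"
    by measurable
  then show ?thesis
    unfolding circle_measure_def by (subst AE_distr_iff) auto
qed

lemma integral_circle_measure:
  fixes f :: "complex \<Rightarrow> complex"
  assumes [measurable]: "f \<in> borel_measurable borel"
  shows "(LINT w|circle_measure. f w) = (LINT t|lborel. indicator {0..2 * pi} t *\<^sub>R f (cis t)) / (2 * pi)"
proof -
  have "uniform_measure lborel {0..2 * pi} = density lborel (\<lambda>t. ennreal (indicator {0..2 * pi} t / (2 * pi)))"
    unfolding uniform_measure_def
    by (intro density_cong) (auto simp: divide_ennreal split: split_indicator simp flip: ennreal_1)
  then have "(LINT w|circle_measure. f w)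
      = (LINT t|lborel. (indicator {0..2 * pi} t / (2 * pi)) *\<^sub>R f (cis t))"
    unfolding circle_measure_def
    by (subst integral_distr) (measurable, simp add: integral_density)
  also have "\<dots> = (LINT t|lborel. (1 / (2 * pi)) *\<^sub>R (indicator {0..2 * pi} t *\<^sub>R f (cis t)))"
    by (intro Bochner_Integration.integral_cong) auto
  also have "\<dots> = (1 / (2 * pi)) *\<^sub>R (LINT t|lborel. indicator {0..2 * pi} t *\<^sub>R f (cis t))"
    by (rule Bochner_Integration.integral_scaleR_right)
  finally show ?thesis by (simp add: scaleR_conv_of_real)
qed

lemma borel_measurable_power_int [measurable]: "(\<lambda>w::complex. w powi n) \<in> borel_measurable borel"
  unfolding power_int_def by (cases "n \<ge> 0") simp_all

lemma integral_circle_power_int: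
  "(LINT w|circle_measure. w powi n) = (if n = 0 then 1 else 0)"
proof (cases "n = 0")
  case True
  then show ?thesis using circle.prob_space by simp
next
  case False
  \<comment> \<open>an antiderivative of \<open>exp (\<i> * n * t)\<close> with period \<open>2 * pi\<close>\<close>
  define F where "F z = exp (\<i> * of_int n * z) / (\<i> * of_int n)" for z
  have "(F has_field_derivative exp (\<i> * of_int n * z)) (at z)" for z
    unfolding F_def using False by (auto intro!: derivative_eq_intros)
  then have D: "((\<lambda>t. F (of_real t)) has_vector_derivative exp (\<i> * of_int n * of_real t)) (at t within A)" for t A
    by (rule has_vector_derivative_real_field)
  have eq: "cis t powi n = exp (\<i> * of_int n * of_real t)" for t
    unfolding cis_power_int by (simp add: cis_conv_exp mult_ac)
  have "(LINT t|lborel. indicator {0..2 * pi} t *\<^sub>R exp (\<i> * of_int n * of_real t)) = F (of_real (2 * pi)) - F (of_real 0)"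
    by (rule integral_FTC_atLeastAtMost) (auto intro!: D continuous_intros)
  also have "\<dots> = 0"
    unfolding F_def eq[symmetric] by simp
  finally show ?thesis
    using False by (subst integral_circle_measure) (simp_all add: eq)
qed

lemma cnj_power_int_circle: "cmod w = 1 \<Longrightarrow> cnj (w powi n) = w powi (- n)"
proof -
  assume w: "cmod w = 1"
  have "w powi n * cnj (w powi n) = 1"
    using w complex_norm_square[of "w powi n"] by (simp add: norm_power_int)
  moreover have "w powi n \<noteq> 0" using w by auto
  moreover have "w powi n * w powi (- n) = 1"
    using w by (subst power_int_add[symmetric]) auto
  ultimately show ?thesis by (metis mult_left_cancel)
qed

lemma circle_integrable_mult_bounded:
  assumes F: "integrable circle_measure F" and [measurable]: "g \<in> borel_measurable borel"
    and "AE w in circle_measure. cmod (g w) \<le> b"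
  shows "integrable circle_measure (\<lambda>w. F w * g w :: complex)"
proof (rule Bochner_Integration.integrable_bound)
  show "integrable circle_measure (\<lambda>w. b * cmod (F w))" using F by simp
  have [measurable]: "F \<in> borel_measurable borel" 
    using borel_measurable_integrable[OF F] by measurable
  show "(\<lambda>w. F w * g w) \<in> borel_measurable circle_measure" by measurable
  show "AE w in circle_measure. cmod (F w * g w) \<le> norm (b * cmod (F w))"
    using assms(3)
  proof eventually_elim
    fix w assume "cmod (g w) \<le> b"
    then have "cmod (F w * g w) \<le> cmod (F w) * b"
      unfolding norm_mult by (rule mult_left_mono) simp
    also have "\<dots> \<le> norm (b * cmod (F w))" by (simp add: mult.commute)
    finally show "cmod (F w * g w) \<le> norm (b * cmod (F w))" .
  qed
qed

text \<open>
  The moments are integrals against all integer powers of \<open>w\<close>, that is, the Fourier coefficients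
  with the opposite index.
\<close>

definition null_moments :: "(complex \<Rightarrow> complex) \<Rightarrow> bool" where
  "null_moments F \<longleftrightarrow> integrable circle_measure F \<and> (\<forall>n. (LINT w|circle_measure. F w * w powi n) = 0)"

lemma integrable_mult_power_int:
  assumes "integrable circle_measure F"
  shows "integrable circle_measure (\<lambda>w. F w * w powi n :: complex)"
  by (rule circle_integrable_mult_bounded[OF assms, of _ 1])
     (use AE_circle_cmod in \<open>auto elim!: eventually_mono simp: norm_power_int\<close>)

lemma null_moments_measurable: "null_moments F \<Longrightarrow> F \<in> borel_measurable borel"
  using borel_measurable_integrable[of circle_measure F] by (auto simp: null_moments_def)

lemma null_moments_cong:
  assumes "null_moments F" "G \<in> borel_measurable borel" "AE w in circle_measure. F w = G w"
  shows "null_moments G"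
proof -
  have [measurable]: "F \<in> borel_measurable borel" "G \<in> borel_measurable borel"
    using assms(1,2) by (auto intro: null_moments_measurable)
  have "integrable circle_measure G"
    using integrable_cong_AE[of F circle_measure G] assms by (auto simp: null_moments_def)
  moreover have "(LINT w|circle_measure. G w * w powi n) = (LINT w|circle_measure. F w * w powi n)" for n
    by (rule integral_cong_AE) (use assms(3) in \<open>auto elim!: eventually_mono\<close>)
  ultimately show ?thesis using assms(1) by (simp add: null_moments_def)
qed

lemma null_moments_power_int:
  assumes F: "null_moments F"
  shows "null_moments (\<lambda>w. F w * w powi m)"
  unfolding null_moments_def
proof (intro conjI allI)
  have [measurable]: "F \<in> borel_measurable borel" using F by (rule null_moments_measurable)
  have int: "integrable circle_measure F" using F by (simp add: null_moments_def)
  then show "integrable circle_measure (\<lambda>w. F w * w powi m)" by (rule integrable_mult_power_int)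
  fix n
  have "(LINT w|circle_measure. F w * w powi m * w powi n) = (LINT w|circle_measure. F w * w powi (m + n))"
  proof (rule integral_cong_AE)
    show "AE w in circle_measure. F w * w powi m * w powi n = F w * w powi (m + n)"
      using AE_circle_cmod by eventually_elim (subst power_int_add; auto)
  qed (simp_all, measurable)
  then show "(LINT w|circle_measure. F w * w powi m * w powi n) = 0"
    using F by (simp add: null_moments_def)
qed

lemma null_moments_add:
  "null_moments F \<Longrightarrow> null_moments G \<Longrightarrow> null_moments (\<lambda>w. F w + G w)"
  by (simp add: null_moments_def integrable_mult_power_int distrib_right)

lemma null_moments_cmult: "null_moments F \<Longrightarrow> null_moments (\<lambda>w. c * F w)"
  by (simp add: null_moments_def mult.assoc)

lemma null_moments_cnj:
  assumes F: "null_moments F"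
  shows "null_moments (\<lambda>w. F w * cnj w)"
proof (rule null_moments_cong[OF null_moments_power_int[OF F, of "-1"]])
  have [measurable]: "F \<in> borel_measurable borel" using F by (rule null_moments_measurable)
  show "(\<lambda>w. F w * cnj w) \<in> borel_measurable borel" by measurable
  show "AE w in circle_measure. F w * w powi - 1 = F w * cnj w"
    using AE_circle_cmod
  proof eventually_elim
    fix w :: complex assume "cmod w = 1"
    then show "F w * w powi - 1 = F w * cnj w" using cnj_power_int_circle[of w 1] by simp
  qed
qed

text \<open>
  Generalizing over \<open>F\<close> makes the induction work: the factors of a product of polynomials are
  absorbed into \<open>F\<close> one after the other. On the circle a real linear form is
  \<open>\<alpha> * w + cnj \<alpha> * cnj w\<close> with \<open>cnj w = 1 / w\<close>, and multiplication by a power of \<open>w\<close> only shifts the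
  moments.
\<close>

lemma null_moments_polynomial:
  assumes "real_polynomial_function g" "null_moments F"
  shows "null_moments (\<lambda>w. F w * of_real (g w))"
  using assms
proof (induction g arbitrary: F rule: real_polynomial_function.induct)
  case (linear f)
  interpret bounded_linear f by fact
  define \<alpha> where "\<alpha> = Complex (f 1) (- f \<i>) / 2"
  have fw: "f w = Re w * f 1 + Im w * f \<i>" for w
  proof -
    have "f w = f (Re w *\<^sub>R 1 + Im w *\<^sub>R \<i>)"
      by (rule arg_cong[of _ _ f]) (simp add: complex_eq_iff)
    then show ?thesis by (simp only: add scaleR real_scaleR_def)
  qed
  have "complex_of_real (f w) = \<alpha> * w + cnj \<alpha> * cnj w" for w
    unfolding fw[of w] by (simp add: \<alpha>_def complex_eq_iff field_simps)
  then have *: "(\<lambda>w. F w * of_real (f w)) = (\<lambda>w. \<alpha> * (F w * w powi 1) + cnj \<alpha> * (F w * cnj w))"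
    by (simp add: algebra_simps)
  show ?case
    by (subst *, rule null_moments_add[OF null_moments_cmult[OF null_moments_power_int[OF linear.prems]]
          null_moments_cmult[OF null_moments_cnj[OF linear.prems]]])
next
  case (const c)
  then show ?case using null_moments_cmult[of F "of_real c"] by (simp add: mult.commute)
next
  case (add f g)
  then show ?case by (simp add: distrib_left null_moments_add)
next
  case (mult f g)
  from mult.IH(2)[OF mult.IH(1)[OF mult.prems]] show ?case by (simp add: mult.assoc)
qed

text \<open>
  By the Stone--Weierstrass theorem, \<open>h\<close> is a uniform limit on the circle of polynomials in the
  real and imaginary part of \<open>w\<close>, against which \<open>F\<close> integrates to zero.
\<close>

lemma null_moments_continuous:
  assumes F: "null_moments F" and h: "continuous_on UNIV h"
  shows "(LINT w|circle_measure. F w * of_real (h w)) = 0"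
proof -
  have int: "integrable circle_measure F" using F by (simp add: null_moments_def)
  have [measurable]: "F \<in> borel_measurable borel" using F by (rule null_moments_measurable)
  have [measurable]: "h \<in> borel_measurable borel" using h by (rule borel_measurable_continuous_onI)
  define I where "I = (LINT w|circle_measure. cmod (F w))"
  have I: "I \<ge> 0" by (simp add: I_def)
  have "cmod (LINT w|circle_measure. F w * of_real (h w)) \<le> 0 + e" if e: "e > 0" for e
  proof -
    define d where "d = e / (I + 1)"
    have d: "d > 0" using e I by (simp add: d_def)
    obtain g where g: "real_polynomial_function g" "\<And>w. w \<in> sphere 0 1 \<Longrightarrow> \<bar>h w - g w\<bar> < d"
      by (rule Stone_Weierstrass_real_polynomial_function[of "sphere 0 1" h d])
         (use d continuous_on_subset[OF h] in auto)
    have [measurable]: "g \<in> borel_measurable borel"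
      using g(1) by (intro borel_measurable_continuous_onI continuous_on_polymonial_function)
         (auto simp: real_polynomial_function_eq)
    have nm: "null_moments (\<lambda>w. F w * of_real (g w))"
      by (rule null_moments_polynomial[OF g(1) F])
    have 0: "(LINT w|circle_measure. F w * of_real (g w)) = 0"
      using nm[unfolded null_moments_def, THEN conjunct2, rule_format, of 0] by simp
    have ae: "AE w in circle_measure. cmod (of_real (h w - g w)) \<le> d"
      using AE_circle_cmod by eventually_elim (use g(2) in \<open>auto simp: less_imp_le simp del: of_real_diff\<close>)
    have i1: "integrable circle_measure (\<lambda>w. F w * of_real (h w - g w))"
      by (rule circle_integrable_mult_bounded[OF int _ ae]) measurable
    have i2: "integrable circle_measure (\<lambda>w. F w * of_real (g w))"
      using nm by (simp add: null_moments_def)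
    have "(LINT w|circle_measure. F w * of_real (h w)) = (LINT w|circle_measure. F w * of_real (h w - g w) + F w * of_real (g w))"
      by (simp add: algebra_simps)
    also have "\<dots> = (LINT w|circle_measure. F w * of_real (h w - g w))"
      using i1 i2 0 by (subst Bochner_Integration.integral_add) auto
    finally have "cmod (LINT w|circle_measure. F w * of_real (h w)) \<le> (LINT w|circle_measure. cmod (F w * of_real (h w - g w)))"
      using integral_norm_bound by simp
    also have "\<dots> \<le> (LINT w|circle_measure. cmod (F w) * d)"
    proof (rule integral_mono_AE)
      show "AE w in circle_measure. cmod (F w * of_real (h w - g w)) \<le> cmod (F w) * d"
        using ae by eventually_elim (simp add: norm_mult mult_left_mono)
    qed (use i1 int in auto)
    also have "\<dots> = I * d" by (simp add: I_def)
    also have "\<dots> \<le> e" using I e by (simp add: d_def divide_le_eq algebra_simps)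
    finally show ?thesis by simp
  qed
  then have "cmod (LINT w|circle_measure. F w * of_real (h w)) \<le> 0" by (rule field_le_epsilon)
  then show ?thesis by simp
qed

text \<open>
  The indicator function of a closed set is the pointwise limit of the bounded continuous functions
  \<open>max 0 (1 - k * infdist w C)\<close>.
\<close>

lemma null_moments_closed:
  assumes F: "null_moments F" and C: "closed C"
  shows "(LINT w:C|circle_measure. F w) = 0"
proof (cases "C = {}")
  case True
  then show ?thesis by (simp add: set_lebesgue_integral_def)
next
  case False
  have int: "integrable circle_measure F" using F by (simp add: null_moments_def)
  have [measurable]: "F \<in> borel_measurable borel" using F by (rule null_moments_measurable)
  have [measurable]: "C \<in> sets borel" using C by (rule borel_closed)
  define h where "h k w = max 0 (1 - real k * infdist w C)" for k w
  have cont: "continuous_on UNIV (h k)" for k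
    unfolding h_def by (intro continuous_intros continuous_on_infdist)
  have [measurable]: "h k \<in> borel_measurable borel" for k
    using cont by (rule borel_measurable_continuous_onI)
  have lim: "(\<lambda>k. h k w) \<longlonglongrightarrow> indicator C w" for w
  proof (cases "w \<in> C")
    case True
    then show ?thesis by (simp add: h_def)
  next
    case w: False
    then have pos: "infdist w C > 0"
      using C False infdist_pos_not_in_closed by blast
    have "\<forall>\<^sub>F k in sequentially. h k w = 0"
      using eventually_ge_at_top[of "nat \<lceil>1 / infdist w C\<rceil>"]
    proof eventually_elim
      fix k assume "nat \<lceil>1 / infdist w C\<rceil> \<le> k"
      then have "1 / infdist w C \<le> real k" by linarith
      then show "h k w = 0" using pos by (simp add: h_def divide_le_eq)
    qed
    then show ?thesis using w by (simp add: tendsto_eventually)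
  qed
  have "(\<lambda>k. LINT w|circle_measure. F w * of_real (h k w)) \<longlonglongrightarrow> (LINT w|circle_measure. F w * of_real (indicator C w))"
  proof (rule integral_dominated_convergence[where w = "\<lambda>w. cmod (F w)"])
    show "AE w in circle_measure. (\<lambda>k. F w * of_real (h k w)) \<longlonglongrightarrow> F w * of_real (indicator C w)"
      by (intro AE_I2 tendsto_intros lim)
    have h1: "\<bar>h k w\<bar> \<le> 1" for k w
      by (auto simp: h_def infdist_nonneg)
    show "AE w in circle_measure. cmod (F w * of_real (h k w)) \<le> cmod (F w)" for k
      using mult_left_mono[OF h1 norm_ge_zero] by (auto simp: norm_mult)
    show "(\<lambda>w. F w * complex_of_real (indicator C w)) \<in> borel_measurable circle_measure" by measurable
    show "(\<lambda>w. F w * complex_of_real (h k w)) \<in> borel_measurable circle_measure" for k by measurable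
  qed (use int in auto)
  then have "(LINT w|circle_measure. F w * of_real (indicator C w)) = 0"
    using null_moments_continuous[OF F cont] by (simp add: LIMSEQ_const_iff)
  then show ?thesis
    unfolding set_lebesgue_integral_def by (simp add: scaleR_conv_of_real mult.commute)
qed

text \<open>
  The closed sets generate the Borel sets and are stable under intersection, so \<open>F\<close> integrates to
  zero over every Borel set.
\<close>

lemma null_moments_imp_AE_0:
  assumes F: "null_moments F"
  shows "AE w in circle_measure. F w = 0"
proof (rule circle.density_zero)
  show int: "integrable circle_measure F" using F by (simp add: null_moments_def)
  fix A assume "A \<in> sets circle_measure"
  then have A: "A \<in> sigma_sets UNIV (Collect closed :: complex set set)"
    by (simp add: borel_eq_closed)
  have setint: "set_integrable circle_measure B F" if "B \<in> sigma_sets UNIV (Collect closed)" for B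
    unfolding set_integrable_def using that int by (intro integrable_mult_indicator) (simp_all add: borel_eq_closed)
  have "Int_stable (Collect closed :: complex set set)"
    by (auto simp: Int_stable_def)
  moreover have "Collect closed \<subseteq> Pow (UNIV :: complex set)" by simp
  ultimately show "(LINT w:A|circle_measure. F w) = 0"
    using A
  proof (induction A rule: sigma_sets_induct_disjoint)
    case (basic A)
    then show ?case using null_moments_closed[OF F] by simp
  next
    case empty
    then show ?case by (simp add: set_lebesgue_integral_def)
  next
    case (compl A)
    have UNIV: "UNIV \<in> sigma_sets UNIV (Collect closed :: complex set set)"
      by (rule sigma_sets_top)
    have "(LINT w:UNIV|circle_measure. F w) = (LINT w:A \<union> (UNIV - A)|circle_measure. F w)"
      by simp
    also have "\<dots> = (LINT w:A|circle_measure. F w) + (LINT w:(UNIV - A)|circle_measure. F w)"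
      by (rule set_integral_Un) (use compl setint sigma_sets.Compl in auto)
    finally show ?case
      using compl null_moments_closed[OF F, of UNIV] by simp
  next
    case (union A)
    then have "(LINT w:(\<Union>i. A i)|circle_measure. F w) = (\<Sum>i. (LINT w:(A i)|circle_measure. F w))"
      by (intro lebesgue_integral_countable_add setint sigma_sets.Union)
         (auto simp: borel_eq_closed disjoint_family_on_def)
    with union show ?case by simp
  qed
qed

section \<open>The Hardy space of the circle and the backward shift\<close>

lemma fourier_eq_moment:
  assumes "f \<in> borel_measurable borel"
  shows "fourier f n = (LINT w|circle_measure. f w * w powi (- n))"
  unfolding fourier_def L2_inner_def
proof (rule integral_cong_AE)
  show "AE w in circle_measure. f w * cnj (w powi n) = f w * w powi - n"
    using AE_circle_cmod by eventually_elim (simp only: cnj_power_int_circle)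
qed (use assms in measurable)

lemma L2_power_int: "(\<lambda>w. w powi n) \<in> L2 circle_measure"
  by (rule circle.L2_bounded[of _ 1])
     (use AE_circle_cmod in \<open>auto elim!: eventually_mono simp: norm_power_int\<close>)

lemma fourier_power_int: "fourier (\<lambda>w. w powi m) n = (if m = n then 1 else 0)"
proof -
  have "fourier (\<lambda>w. w powi m) n = (LINT w|circle_measure. w powi m * w powi (- n))"
    by (rule fourier_eq_moment) simp
  also have "\<dots> = (LINT w|circle_measure. w powi (m - n))"
  proof (rule integral_cong_AE)
    show "AE w in circle_measure. w powi m * w powi - n = w powi (m - n)"
      using AE_circle_cmod by eventually_elim (subst power_int_add[symmetric]; auto)
  qed simp_all
  finally show ?thesis by (simp add: integral_circle_power_int)
qed

lemma fourier_unique: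
  assumes f: "f \<in> L2 circle_measure" and g: "g \<in> L2 circle_measure"
    and eq: "\<And>n. fourier f n = fourier g n"
  shows "AE w in circle_measure. f w = g w"
proof -
  have d: "(\<lambda>w. f w - g w) \<in> L2 circle_measure" using f g by (rule L2_diff)
  have "fourier (\<lambda>w. f w - g w) n = 0" for n
    using f g eq[of n] by (simp add: fourier_def L2_inner_diff_left L2_power_int)
  then have "(LINT w|circle_measure. (f w - g w) * w powi n) = 0" for n
    using fourier_eq_moment[of "\<lambda>w. f w - g w" "- n"] L2_measurable[OF d] by simp
  then have "null_moments (\<lambda>w. f w - g w)"
    using circle.L2_integrable[OF d] by (simp add: null_moments_def)
  from null_moments_imp_AE_0[OF this] show ?thesis by eventually_elim simp
qed

interpretation circle: orthogonal_sequence circle_measure "\<lambda>n w. w ^ n" "\<lambda>_. 1"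
proof
  show "(\<lambda>w. w ^ n) \<in> L2 circle_measure" for n
    using L2_power_int[of "int n"] by simp
  show "L2_inner circle_measure (\<lambda>w. w ^ m) (\<lambda>w. w ^ n) = (if m = n then of_real 1 else 0)" for m n
    using fourier_power_int[of "int m" "int n"] by (simp add: fourier_def)
qed simp

lemma circle_coef: "circle.coef f n = fourier f (int n)"
  by (simp add: circle.coef_def fourier_def)

text \<open>
  The projection of \<open>f\<close> onto the closed span of the nonnegative powers has the same Fourier
  coefficients as \<open>f\<close>; those with negative index vanish for both. By uniqueness the two functions
  agree almost everywhere.
\<close>

lemma hardy_circle_psum_tendsto:
  assumes "f \<in> hardy_circle"
  shows "(\<lambda>N. L2_norm circle_measure (\<lambda>w. f w - circle.psum f N w)) \<longlonglongrightarrow> 0"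
proof -
  have f: "f \<in> L2 circle_measure" and neg: "\<And>n. n < 0 \<Longrightarrow> fourier f n = 0"
    using assms by (auto simp: hardy_circle_def)
  obtain g where g: "g \<in> L2 circle_measure"
    and lim: "(\<lambda>N. L2_norm circle_measure (\<lambda>w. g w - circle.psum f N w)) \<longlonglongrightarrow> 0"
    and orth: "\<And>k. L2_inner circle_measure (\<lambda>w. f w - g w) (\<lambda>w. w ^ k) = 0"
    by (rule circle.projection_exists[OF f], rule that)
  have "fourier f n = fourier g n" for n
  proof (cases "n \<ge> 0")
    case True
    then show ?thesis
      using orth[of "nat n"] f g L2_power_int[of n]
      by (simp add: fourier_def L2_inner_diff_left power_int_def)
  next
    case False
    have "L2_inner circle_measure (circle.psum f N) (\<lambda>w. w powi n) = 0" for N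
    proof -
      have "L2_inner circle_measure (circle.psum f N) (\<lambda>w. w powi n)
          = (\<Sum>k<N. circle.coef f k * fourier (\<lambda>w. w powi int k) n)"
        unfolding circle.psum_def fourier_def
        by (subst L2_inner_sum_left) (auto simp: L2_power_int circle.L2_e L2_cmult L2_inner_cmult_left)
      also have "\<dots> = 0" using False fourier_power_int[of "int _" n] by (intro sum.neutral) auto
      finally show ?thesis .
    qed
    moreover have "(\<lambda>N. L2_inner circle_measure (circle.psum f N) (\<lambda>w. w powi n))
        \<longlonglongrightarrow> L2_inner circle_measure g (\<lambda>w. w powi n)"
      by (rule L2_inner_tendsto[OF circle.L2_psum g L2_power_int lim])
    ultimately have "fourier g n = 0" by (simp add: fourier_def LIMSEQ_const_iff)
    then show ?thesis using neg[of n] False by simp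
  qed
  then have ae: "AE w in circle_measure. f w = g w" by (rule fourier_unique[OF f g])
  have "L2_norm circle_measure (\<lambda>w. f w - circle.psum f N w)
      = L2_norm circle_measure (\<lambda>w. g w - circle.psum f N w)" for N
  proof -
    have [measurable]: "f \<in> borel_measurable circle_measure" "g \<in> borel_measurable circle_measure"
      "circle.psum f N \<in> borel_measurable circle_measure"
      using f g circle.L2_psum[of f N] by (auto simp: L2_def)
    have "AE w in circle_measure. (cmod (f w - circle.psum f N w))\<^sup>2 = (cmod (g w - circle.psum f N w))\<^sup>2"
      using ae by eventually_elim simp
    then show ?thesis
      unfolding L2_norm_def by (intro arg_cong[of _ _ sqrt] integral_cong_AE) measurable
  qed
  with lim show ?thesis by simp
qed

text \<open>
  The backward shift is defined by a choice. The function \<open>(f(w) - f(0)) / w\<close>, where \<open>f(0)\<close> is the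
  zeroth Fourier coefficient, shows that the choice is possible.
\<close>

lemma backward_shift_hardy:
  assumes "f \<in> hardy_circle"
  shows "backward_shift f \<in> hardy_circle"
    and "fourier (backward_shift f) (int k) = fourier f (int k + 1)"
proof -
  have f: "f \<in> L2 circle_measure" and neg: "\<And>n. n < 0 \<Longrightarrow> fourier f n = 0"
    using assms by (auto simp: hardy_circle_def)
  have [measurable]: "f \<in> borel_measurable borel" using L2_measurable[OF f] by simp
  define g where "g w = w powi - 1 * f w - fourier f 0 * w powi - 1" for w
  have sf: "(\<lambda>w. w powi - 1 * f w) \<in> L2 circle_measure"
  proof (rule L2_dominatedI[OF _ L2_integrable_power2[OF f]])
    show "AE w in circle_measure. (cmod (w powi - 1 * f w))\<^sup>2 \<le> (cmod (f w))\<^sup>2"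
      using AE_circle_cmod by eventually_elim (simp add: norm_mult norm_power_int norm_inverse)
    show "(\<lambda>w. w powi - 1 * f w) \<in> borel_measurable circle_measure"
      unfolding borel_measurable_circle by measurable
  qed
  have gL2: "g \<in> L2 circle_measure"
    unfolding g_def by (intro L2_diff sf L2_cmult L2_power_int)
  have fourier_sf: "fourier (\<lambda>w. w powi - 1 * f w) n = fourier f (n + 1)" for n
  proof -
    have "fourier (\<lambda>w. w powi - 1 * f w) n = (LINT w|circle_measure. w powi - 1 * f w * w powi (- n))"
      by (rule fourier_eq_moment) measurable
    also have "\<dots> = (LINT w|circle_measure. f w * w powi (- (n + 1)))"
    proof (rule integral_cong_AE)
      show "AE w in circle_measure. w powi - 1 * f w * w powi (- n) = f w * w powi (- (n + 1))"
        using AE_circle_cmod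
      proof eventually_elim
        fix w :: complex assume "cmod w = 1"
        then have "w powi (- 1 + - n) = w powi - 1 * w powi (- n)"
          by (intro power_int_add) auto
        then have "w powi (- (n + 1)) = w powi - 1 * w powi (- n)"
          by (simp add: add.commute)
        then show "w powi - 1 * f w * w powi (- n) = f w * w powi (- (n + 1))"
          by (simp only: mult_ac)
      qed
    qed (unfold borel_measurable_circle, measurable)
    also have "\<dots> = fourier f (n + 1)"
      by (rule fourier_eq_moment[symmetric]) simp
    finally show ?thesis .
  qed
  have fourier_g: "fourier g n = fourier f (n + 1) - (if n = - 1 then fourier f 0 else 0)" for n
  proof -
    have "fourier g n = fourier (\<lambda>w. w powi - 1 * f w) n - fourier f 0 * fourier (\<lambda>w. w powi - 1) n"
      unfolding g_def fourier_def[of _ n]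
      by (simp only: L2_inner_diff_left[OF sf L2_cmult[OF L2_power_int] L2_power_int] L2_inner_cmult_left)
    then show ?thesis
      unfolding fourier_sf fourier_power_int by auto
  qed
  have "fourier g n = 0" if "n < 0" for n
    using that neg[of "n + 1"] by (cases "n = - 1") (auto simp: fourier_g)
  then have "g \<in> hardy_circle \<and> (\<forall>k::nat. fourier g (int k) = fourier f (int k + 1))"
    using gL2 fourier_g by (simp add: hardy_circle_def)
  then have *: "backward_shift f \<in> hardy_circle \<and>
      (\<forall>k::nat. fourier (backward_shift f) (int k) = fourier f (int k + 1))"
    unfolding backward_shift_def
    by (rule someI[of "\<lambda>g. g \<in> hardy_circle \<and> (\<forall>k::nat. fourier g (int k) = fourier f (int k + 1))"])
  from * show "backward_shift f \<in> hardy_circle" by blast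
  from * show "fourier (backward_shift f) (int k) = fourier f (int k + 1)" by blast
qed

lemma backward_shift_funpow:
  assumes "f \<in> hardy_circle"
  shows "(backward_shift ^^ j) f \<in> hardy_circle \<and>
    (\<forall>k::nat. fourier ((backward_shift ^^ j) f) (int k) = fourier f (int (j + k)))"
proof (induction j)
  case 0
  then show ?case using assms by simp
next
  case (Suc j)
  have "fourier ((backward_shift ^^ Suc j) f) (int k) = fourier f (int (Suc j + k))" for k
    using Suc backward_shift_hardy(2)[of "(backward_shift ^^ j) f" k]
      Suc[THEN conjunct2, rule_format, of "Suc k"] by (simp add: add.commute)
  then show ?case using Suc backward_shift_hardy(1) by simp
qed

text \<open>
  The integral is the inner product of \<open>f\<close> with \<open>w ^ m * f\<close>, whose Fourier coefficients are those of
  \<open>f\<close> moved by \<open>m\<close> places. Parseval's formula gives the sum.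
\<close>

lemma moment_hardy_circle:
  assumes f: "f \<in> hardy_circle"
  shows "(\<lambda>k. fourier f (int (k + m)) * cnj (fourier f (int k))) sums
    (LINT w|circle_measure. of_real ((cmod (f w))\<^sup>2) * cnj (w ^ m))"
proof -
  have fL2: "f \<in> L2 circle_measure" and neg: "\<And>n. n < 0 \<Longrightarrow> fourier f n = 0"
    using f by (auto simp: hardy_circle_def)
  have [measurable]: "f \<in> borel_measurable borel" using L2_measurable[OF fL2] by simp
  have gL2: "(\<lambda>w. w ^ m * f w) \<in> L2 circle_measure"
  proof (rule L2_dominatedI[OF _ L2_integrable_power2[OF fL2]])
    show "AE w in circle_measure. (cmod (w ^ m * f w))\<^sup>2 \<le> (cmod (f w))\<^sup>2"
      using AE_circle_cmod by eventually_elim (simp add: norm_mult norm_power)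
    show "(\<lambda>w. w ^ m * f w) \<in> borel_measurable circle_measure"
      unfolding borel_measurable_circle by measurable
  qed
  have inner: "L2_inner circle_measure (\<lambda>w. w ^ n) (\<lambda>w. w ^ m * f w) = cnj (fourier f (int n - int m))" for n
  proof -
    have "L2_inner circle_measure (\<lambda>w. w ^ m * f w) (\<lambda>w. w ^ n) = (LINT w|circle_measure. f w * w powi (- (int n - int m)))"
      unfolding L2_inner_def
    proof (rule integral_cong_AE)
      show "AE w in circle_measure. w ^ m * f w * cnj (w ^ n) = f w * w powi (- (int n - int m))"
        using AE_circle_cmod
      proof eventually_elim
        fix w :: complex assume w: "cmod w = 1"
        then have "w powi (int m + - int n) = w powi int m * w powi (- int n)"
          by (intro power_int_add) auto
        then show "w ^ m * f w * cnj (w ^ n) = f w * w powi (- (int n - int m))"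
          using cnj_power_int_circle[OF w, of "int n"] by (simp add: mult_ac)
      qed
    qed (unfold borel_measurable_circle, measurable)
    also have "\<dots> = fourier f (int n - int m)"
      by (rule fourier_eq_moment[symmetric]) simp
    finally show ?thesis by (metis cnj_L2_inner)
  qed
  define a where "a n = circle.coef f n * L2_inner circle_measure (\<lambda>w. w ^ n) (\<lambda>w. w ^ m * f w)" for n
  have "a sums L2_inner circle_measure f (\<lambda>w. w ^ m * f w)"
    unfolding a_def by (rule circle.Parseval[OF fL2 hardy_circle_psum_tendsto[OF f] gL2])
  moreover have "a n = 0" if "n < m" for n
    using that by (simp add: a_def inner neg)
  ultimately have "(\<lambda>k. a (k + m)) sums L2_inner circle_measure f (\<lambda>w. w ^ m * f w)"
    by (simp add: sums_zero_iff_shift)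
  moreover have "a (k + m) = fourier f (int (k + m)) * cnj (fourier f (int k))" for k
    by (simp add: a_def inner circle_coef)
  moreover have "L2_inner circle_measure f (\<lambda>w. w ^ m * f w)
      = (LINT w|circle_measure. of_real ((cmod (f w))\<^sup>2) * cnj (w ^ m))"
    unfolding L2_inner_def
    by (intro Bochner_Integration.integral_cong) (simp_all add: complex_norm_square mult_ac del: of_real_power)
  ultimately show ?thesis by simp
qed

text \<open>
  The term \<open>h n\<close> is counted once for each pair \<open>(j, k)\<close> with \<open>j + k = n\<close>, and there are \<open>n + 1\<close>
  such pairs. Absolute summability permits the rearrangement.
\<close>

lemma sums_diagonals:
  fixes h :: "nat \<Rightarrow> complex"
  assumes "summable (\<lambda>n. real (n + 1) * cmod (h n))"
  shows "(\<lambda>j. \<Sum>k. h (j + k)) sums (\<Sum>n. of_nat (n + 1) * h n)"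
proof -
  define f where "f p = h (fst p + snd p)" for p :: "nat \<times> nat"
  have abs: "summable (\<lambda>n. norm (of_nat (n + 1) * h n))"
    unfolding norm_mult norm_of_nat by (rule assms)
  have outer: "((\<lambda>n. of_nat (n + 1) * h n) has_sum (\<Sum>n. of_nat (n + 1) * h n)) UNIV"
    by (rule norm_summable_imp_has_sum[OF abs summable_sums[OF summable_norm_cancel[OF abs]]])
  have inner: "((\<lambda>i. h n) has_sum (of_nat (n + 1) * h n)) {..n}" for n
    by (rule has_sum_finiteI) auto
  have "(\<lambda>p. norm (case p of (n, i) \<Rightarrow> h n)) summable_on (SIGMA n:UNIV. {..n})"
  proof (subst Infinite_Sum.abs_summable_on_Sigma_iff, intro conjI ballI)
    show "(\<lambda>n. norm (infsum (\<lambda>i. norm (case (n, i) of (n, i) \<Rightarrow> h n)) {..n})) summable_on UNIV"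
      using norm_summable_imp_summable_on[of "\<lambda>n. real (n + 1) * cmod (h n)"] assms
      by (simp add: abs_mult)
  qed auto
  then have "(\<lambda>(n, i). h n) summable_on (SIGMA n:UNIV. {..n})"
    by (rule Infinite_Sum.abs_summable_summable)
  then have S: "((\<lambda>(n, i). h n) has_sum (\<Sum>n. of_nat (n + 1) * h n)) (SIGMA n:UNIV. {..n})"
    by (intro has_sum_SigmaI[OF _ outer]) (use inner in auto)
  have "(f has_sum (\<Sum>n. of_nat (n + 1) * h n)) (UNIV \<times> UNIV)
      \<longleftrightarrow> ((\<lambda>(n, i). h n) has_sum (\<Sum>n. of_nat (n + 1) * h n)) (SIGMA n:UNIV. {..n})"
    by (rule has_sum_reindex_bij_witness[of _ "\<lambda>(n, j). (j, n - j)" "\<lambda>(j, k). (j + k, j)"])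
       (auto simp: f_def)
  with S have "(f has_sum (\<Sum>n. of_nat (n + 1) * h n)) (UNIV \<times> UNIV)" by simp
  then have "((\<lambda>j. \<Sum>k. h (j + k)) has_sum (\<Sum>n. of_nat (n + 1) * h n)) UNIV"
  proof (rule has_sum_SigmaD)
    fix j
    have "summable (\<lambda>n. norm (h n))"
    proof (rule summable_comparison_test'[OF assms, of 0])
      show "norm (norm (h n)) \<le> real (n + 1) * cmod (h n)" for n
        using mult_right_mono[of 1 "real (n + 1)" "cmod (h n)"] by simp
    qed
    then have "summable (\<lambda>k. norm (h (k + j)))" by (rule summable_ignore_initial_segment)
    then have s: "summable (\<lambda>k. norm (h (j + k)))" by (simp add: add.commute)
    show "((\<lambda>k. f (j, k)) has_sum (\<Sum>k. h (j + k))) UNIV"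
      unfolding f_def fst_conv snd_conv
      by (rule norm_summable_imp_has_sum[OF s summable_sums[OF summable_norm_cancel[OF s]]])
  qed
  then show ?thesis by (rule has_sum_imp_sums)
qed

section \<open>Orbits of the backward shift\<close>

text \<open>
  The function \<open>\<Sum>j. |f\<^sub>j|\<^sup>2\<close>, with \<open>f\<^sub>j\<close> the \<open>j\<close>-th backward shift of \<open>f\<close>, is integrable by the weighted
  summability of the coefficients, and the sums assumed to vanish are its Fourier coefficients with
  positive index. It is real, so the coefficients with negative index vanish as well.
\<close>

lemma backward_shift_orbit_constant:
  assumes f: "f \<in> hardy_circle"
    and sq: "summable (\<lambda>n. real (n + 1) * (cmod (fourier f (int n)))\<^sup>2)"
    and null: "\<And>m. m \<ge> 1 \<Longrightarrow>
      (\<lambda>n. of_nat (n + 1) * (fourier f (int (n + m)) * cnj (fourier f (int n)))) sums 0"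
  shows "\<exists>c. AE w in circle_measure. (\<lambda>j. (cmod ((backward_shift ^^ j) f w))\<^sup>2) sums c"
proof -
  define a where "a n = fourier f (int n)" for n :: nat
  define F where "F j = (backward_shift ^^ j) f" for j
  have F: "F j \<in> hardy_circle" and a_F: "fourier (F j) (int k) = a (j + k)" for j k
    using backward_shift_funpow[OF f, of j] by (auto simp: F_def a_def)
  have FL2: "F j \<in> L2 circle_measure" for j using F[of j] by (simp add: hardy_circle_def)
  have [measurable]: "F j \<in> borel_measurable borel" for j using L2_measurable[OF FL2[of j]] by simp
  have summ: "summable (\<lambda>n. real (n + 1) * cmod (a (n + m) * cnj (a n)))" for m
  proof (rule summable_comparison_test')
    show "summable (\<lambda>n. real (n + m + 1) * (cmod (a (n + m)))\<^sup>2 + real (n + 1) * (cmod (a n))\<^sup>2)"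
      using sq summable_ignore_initial_segment[OF sq, of m] unfolding a_def by (intro summable_add)
    show "norm (real (n + 1) * cmod (a (n + m) * cnj (a n)))
        \<le> real (n + m + 1) * (cmod (a (n + m)))\<^sup>2 + real (n + 1) * (cmod (a n))\<^sup>2" for n
    proof -
      have "cmod (a (n + m)) * cmod (a n) \<le> (cmod (a (n + m)))\<^sup>2 + (cmod (a n))\<^sup>2"
        using sum_squares_bound[of "cmod (a (n + m))" "cmod (a n)"]
          mult_nonneg_nonneg[OF norm_ge_zero norm_ge_zero, of "a (n + m)" "a n"] by linarith
      then have "real (n + 1) * (cmod (a (n + m)) * cmod (a n))
          \<le> real (n + 1) * ((cmod (a (n + m)))\<^sup>2 + (cmod (a n))\<^sup>2)"
        by (intro mult_left_mono) auto
      also have "\<dots> \<le> real (n + m + 1) * (cmod (a (n + m)))\<^sup>2 + real (n + 1) * (cmod (a n))\<^sup>2"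
        by (simp add: distrib_left mult_right_mono)
      finally show ?thesis by (simp add: norm_mult abs_mult)
    qed
  qed
  \<comment> \<open>the \<open>m\<close>-th Fourier coefficient of the \<open>j\<close>-th summand\<close>
  define I where "I m j = (LINT w|circle_measure. of_real ((cmod (F j w))\<^sup>2) * cnj (w ^ m))" for m j
  have I_eq: "I m j = (\<Sum>k. a (j + k + m) * cnj (a (j + k)))" for m j
    using sums_unique[OF moment_hardy_circle[OF F[of j], of m]] unfolding I_def a_F
    by (simp add: a_F add.assoc flip: of_nat_add)
  have I_sums: "I m sums (\<Sum>n. of_nat (n + 1) * (a (n + m) * cnj (a n)))" for m
    using sums_diagonals[OF summ[of m]] unfolding I_eq .
  have int: "integrable circle_measure (\<lambda>w. (cmod (F j w))\<^sup>2)" for j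
    by (rule L2_integrable_power2[OF FL2])
  have I0: "I 0 j = of_real (LINT w|circle_measure. (cmod (F j w))\<^sup>2)" for j
    unfolding I_def by (simp flip: integral_complex_of_real)
  have sum_norms: "summable (\<lambda>j. LINT w|circle_measure. (cmod (F j w))\<^sup>2)"
    using sums_summable[OF I_sums[of 0]] unfolding I0 summable_complex_of_real .
  have ae_summable: "AE w in circle_measure. summable (\<lambda>j. (cmod (F j w))\<^sup>2)"
  proof -
    have "(\<integral>\<^sup>+w. (\<Sum>j. ennreal ((cmod (F j w))\<^sup>2)) \<partial>circle_measure)
        = (\<Sum>j. (\<integral>\<^sup>+w. ennreal ((cmod (F j w))\<^sup>2) \<partial>circle_measure))"
      by (rule nn_integral_suminf) simp
    also have "\<dots> = (\<Sum>j. ennreal (LINT w|circle_measure. (cmod (F j w))\<^sup>2))"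
      by (intro suminf_cong nn_integral_eq_integral int) simp
    also have "\<dots> = ennreal (\<Sum>j. LINT w|circle_measure. (cmod (F j w))\<^sup>2)"
      by (rule suminf_ennreal_eq) (use summable_sums[OF sum_norms] in auto)
    finally have "(\<integral>\<^sup>+w. (\<Sum>j. ennreal ((cmod (F j w))\<^sup>2)) \<partial>circle_measure) \<noteq> \<infinity>" by simp
    then have "AE w in circle_measure. (\<Sum>j. ennreal ((cmod (F j w))\<^sup>2)) \<noteq> \<infinity>"
      by (intro nn_integral_PInf_AE) simp_all
    then show ?thesis
      by eventually_elim (rule summable_suminf_not_top, auto)
  qed
  define S where "S w = (\<Sum>j. complex_of_real ((cmod (F j w))\<^sup>2))" for w
  have S_real: "cnj (S w) = S w" if "summable (\<lambda>j. (cmod (F j w))\<^sup>2)" for w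
    unfolding S_def using that by (simp add: suminf_of_real[symmetric] del: of_real_power)
  have Sm: "integrable circle_measure (\<lambda>w. \<Sum>j. of_real ((cmod (F j w))\<^sup>2) * cnj (w ^ m)) \<and>
      I m sums (LINT w|circle_measure. (\<Sum>j. of_real ((cmod (F j w))\<^sup>2) * cnj (w ^ m)))" for m
  proof -
    have norm_eq: "AE w in circle_measure. norm (of_real ((cmod (F j w))\<^sup>2) * cnj (w ^ m)) = (cmod (F j w))\<^sup>2" for j
      using AE_circle_cmod by eventually_elim (simp add: norm_mult norm_power)
    have 1: "integrable circle_measure (\<lambda>w. of_real ((cmod (F j w))\<^sup>2) * cnj (w ^ m))" for j
    proof (rule circle_integrable_mult_bounded[where b = 1])
      show "AE w in circle_measure. cmod (cnj (w ^ m)) \<le> 1"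
        using AE_circle_cmod by eventually_elim (simp add: norm_power)
    qed (use int[of j] in \<open>auto simp del: of_real_power\<close>)
    have 2: "AE w in circle_measure. summable (\<lambda>j. norm (of_real ((cmod (F j w))\<^sup>2) * cnj (w ^ m)))"
      using ae_summable AE_circle_cmod by eventually_elim (simp add: norm_mult norm_power)
    have 3: "summable (\<lambda>j. LINT w|circle_measure. norm (of_real ((cmod (F j w))\<^sup>2) * cnj (w ^ m)))"
    proof -
      have "(LINT w|circle_measure. norm (of_real ((cmod (F j w))\<^sup>2) * cnj (w ^ m)))
          = (LINT w|circle_measure. (cmod (F j w))\<^sup>2)" for j
        by (rule integral_cong_AE[OF _ _ norm_eq]) simp_all
      then show ?thesis using sum_norms by simp
    qed
    show ?thesis
      using integrable_suminf[OF 1 2 3] sums_integral[OF 1 2 3] by (simp add: I_def[abs_def])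
  qed
  have S_factor: "(\<Sum>j. of_real ((cmod (F j w))\<^sup>2) * cnj (w ^ m)) = S w * cnj (w ^ m)"
    if "summable (\<lambda>j. (cmod (F j w))\<^sup>2)" for w m
    unfolding S_def using that by (intro suminf_mult2[symmetric]) (simp del: of_real_power add: summable_complex_of_real)
  have S_meas [measurable]: "S \<in> borel_measurable borel" unfolding S_def by measurable
  have S_int: "integrable circle_measure S"
    using Sm[of 0] unfolding S_def by simp
  have moment: "(LINT w|circle_measure. S w * cnj (w ^ m)) = 0" if m: "m \<ge> 1" for m
  proof -
    have "(LINT w|circle_measure. S w * cnj (w ^ m)) = (LINT w|circle_measure. (\<Sum>j. of_real ((cmod (F j w))\<^sup>2) * cnj (w ^ m)))"
    proof (rule integral_cong_AE)
      show "AE w in circle_measure. S w * cnj (w ^ m) = (\<Sum>j. of_real ((cmod (F j w))\<^sup>2) * cnj (w ^ m))"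
        using ae_summable by eventually_elim (simp only: S_factor)
    qed simp_all
    also have "\<dots> = (\<Sum>n. of_nat (n + 1) * (a (n + m) * cnj (a n)))"
      using Sm[of m] I_sums[of m] sums_unique2 by blast
    also have "\<dots> = 0"
      using sums_unique[OF null[OF m]] by (simp add: a_def)
    finally show ?thesis .
  qed
  define c where "c = (LINT w|circle_measure. S w)"
  have "null_moments (\<lambda>w. S w - c)"
    unfolding null_moments_def
  proof (intro conjI allI)
    show "integrable circle_measure (\<lambda>w. S w - c)" using S_int by simp
    fix n :: int
    have "(LINT w|circle_measure. (S w - c) * w powi n) = (LINT w|circle_measure. S w * w powi n - c * w powi n)"
      by (simp add: left_diff_distrib)
    also have "\<dots> = (LINT w|circle_measure. S w * w powi n) - c * (LINT w|circle_measure. w powi n)"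
      using integrable_mult_power_int[OF S_int, of n] circle.L2_integrable[OF L2_power_int[of n]]
      by (subst Bochner_Integration.integral_diff) auto
    finally have *: "(LINT w|circle_measure. (S w - c) * w powi n)
        = (LINT w|circle_measure. S w * w powi n) - c * (if n = 0 then 1 else 0)"
      by (simp only: integral_circle_power_int)
    consider "n = 0" | m where "n = - int m" "m \<ge> 1" | m where "n = int m" "m \<ge> 1"
      by (metis One_nat_def Suc_leI int_cases3 of_nat_0_less_iff)
    then show "(LINT w|circle_measure. (S w - c) * w powi n) = 0"
    proof cases
      case 1
      then show ?thesis using * by (simp add: c_def)
    next
      case (2 m)
      have "(LINT w|circle_measure. S w * w powi n) = (LINT w|circle_measure. S w * cnj (w ^ m))"
      proof (rule integral_cong_AE)
        show "AE w in circle_measure. S w * w powi n = S w * cnj (w ^ m)"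
          using AE_circle_cmod
        proof eventually_elim
          fix w :: complex assume "cmod w = 1"
          from cnj_power_int_circle[OF this, of "int m"] 2 show "S w * w powi n = S w * cnj (w ^ m)" by simp
        qed
      qed simp_all
      then show ?thesis using * 2 moment by simp
    next
      case (3 m)
      have "(LINT w|circle_measure. S w * w powi n) = (LINT w|circle_measure. cnj (S w * cnj (w ^ m)))"
      proof (rule integral_cong_AE)
        show "AE w in circle_measure. S w * w powi n = cnj (S w * cnj (w ^ m))"
          using ae_summable by eventually_elim (use 3 S_real in simp)
      qed simp_all
      also have "\<dots> = cnj (LINT w|circle_measure. S w * cnj (w ^ m))"
        by (rule Bochner_Integration.integral_cnj)
      finally show ?thesis using * 3 moment by simp
    qed
  qed
  then have "AE w in circle_measure. S w - c = 0" by (rule null_moments_imp_AE_0)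
  with ae_summable have "AE w in circle_measure. (\<lambda>j. (cmod (F j w))\<^sup>2) sums Re c"
  proof eventually_elim
    fix w assume s: "summable (\<lambda>j. (cmod (F j w))\<^sup>2)" and "S w - c = 0"
    then have "c = of_real (\<Sum>j. (cmod (F j w))\<^sup>2)"
      unfolding S_def by (simp add: suminf_of_real del: of_real_power)
    then show "(\<lambda>j. (cmod (F j w))\<^sup>2) sums Re c" using s by (simp add: summable_sums)
  qed
  then show ?thesis unfolding F_def by blast
qed

section \<open>The torus and the homogeneous polynomials\<close>

interpretation circle_pair: pair_sigma_finite circle_measure circle_measure ..

lemma sets_torus_measure [simp]: "sets torus_measure = sets borel"
proof -
  have "sets torus_measure = sets (borel \<Otimes>\<^sub>M borel :: (complex \<times> complex) measure)"
    unfolding torus_measure_def by (intro sets_pair_measure_cong) simp_all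
  then show ?thesis by (simp only: borel_prod)
qed

lemma borel_measurable_torus [simp]: "borel_measurable torus_measure = borel_measurable borel"
  by (rule measurable_cong_sets) simp_all

lemma prob_space_torus_measure: "prob_space torus_measure"
proof -
  interpret pair_prob_space circle_measure circle_measure ..
  show ?thesis unfolding torus_measure_def by (rule prob_space_axioms)
qed

interpretation torus: prob_space torus_measure
  by (rule prob_space_torus_measure)

lemma AE_torus_cmod: "AE p in torus_measure. cmod (fst p) = 1 \<and> cmod (snd p) = 1"
  unfolding torus_measure_def
proof (rule circle_pair.AE_pair_measure)
  have "{p :: complex \<times> complex. cmod (fst p) = 1 \<and> cmod (snd p) = 1} \<in> sets torus_measure"
    unfolding sets_torus_measure
    by (intro borel_closed closed_Collect_conj closed_Collect_eq continuous_intros)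
  then show "{p \<in> space (circle_measure \<Otimes>\<^sub>M circle_measure). cmod (fst p) = 1 \<and> cmod (snd p) = 1}
      \<in> sets (circle_measure \<Otimes>\<^sub>M circle_measure)"
    by (simp only: torus_measure_def space_pair_measure space_circle_measure UNIV_Times_UNIV UNIV_I simp_thms)
  show "AE z in circle_measure. AE w in circle_measure. cmod (fst (z, w)) = 1 \<and> cmod (snd (z, w)) = 1"
    using AE_circle_cmod
  proof eventually_elim
    fix z :: complex assume "cmod z = 1"
    then show "AE w in circle_measure. cmod (fst (z, w)) = 1 \<and> cmod (snd (z, w)) = 1"
      using AE_circle_cmod by simp
  qed
qed

definition monomial :: "int \<Rightarrow> int \<Rightarrow> complex \<times> complex \<Rightarrow> complex" where
  "monomial a b p = fst p powi a * snd p powi b"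

lemma monomial_measurable [measurable]: "monomial a b \<in> borel_measurable borel"
proof -
  have [measurable]: "fst \<in> measurable (borel :: (complex \<times> complex) measure) borel"
    "snd \<in> measurable (borel :: (complex \<times> complex) measure) borel"
    by (auto intro!: borel_measurable_continuous_onI continuous_intros)
  have "(\<lambda>p. fst p powi a) \<in> borel_measurable (borel :: (complex \<times> complex) measure)"
    by (rule measurable_compose[of fst _ borel]) measurable
  moreover have "(\<lambda>p. snd p powi b) \<in> borel_measurable (borel :: (complex \<times> complex) measure)"
    by (rule measurable_compose[of snd _ borel]) measurable
  ultimately show ?thesis unfolding monomial_def[abs_def] by (rule borel_measurable_times)
qed

lemma AE_torus_cmod_monomial: "AE p in torus_measure. cmod (monomial a b p) = 1"
  using AE_torus_cmod by eventually_elim (simp add: monomial_def norm_mult norm_power_int)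

lemma L2_monomial: "monomial a b \<in> L2 torus_measure"
proof (rule torus.L2_bounded)
  show "AE p in torus_measure. cmod (monomial a b p) \<le> 1"
    using AE_torus_cmod_monomial[of a b] by eventually_elim simp
qed simp

lemma L2_inner_monomial:
  "L2_inner torus_measure (monomial a b) (monomial c d) = (if a = c \<and> b = d then 1 else 0)"
proof -
  let ?f = "\<lambda>z w. monomial a b (z, w) * cnj (monomial c d (z, w))"
  have int: "integrable (circle_measure \<Otimes>\<^sub>M circle_measure) (\<lambda>(z, w). ?f z w)"
    using integrable_L2_inner[OF L2_monomial L2_monomial, of a b c d]
    by (simp add: torus_measure_def split_def)
  have "L2_inner torus_measure (monomial a b) (monomial c d) = (LINT z|circle_measure. (LINT w|circle_measure. ?f z w))"
    unfolding circle_pair.integral_fst[OF int]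
    by (simp add: L2_inner_def torus_measure_def split_def)
  also have "\<dots> = (LINT z|circle_measure. z powi a * cnj (z powi c) * fourier (\<lambda>w. w powi b) d)"
  proof (rule Bochner_Integration.integral_cong[OF refl])
    fix z
    have "(LINT w|circle_measure. ?f z w)
        = (LINT w|circle_measure. (z powi a * cnj (z powi c)) * (w powi b * cnj (w powi d)))"
      by (simp add: monomial_def mult_ac)
    then show "(LINT w|circle_measure. ?f z w) = z powi a * cnj (z powi c) * fourier (\<lambda>w. w powi b) d"
      by (simp add: fourier_def L2_inner_def)
  qed
  also have "\<dots> = fourier (\<lambda>z. z powi a) c * fourier (\<lambda>w. w powi b) d"
    by (simp add: fourier_def L2_inner_def)
  finally show ?thesis by (simp add: fourier_power_int)
qed

lemma hom_poly_eq_sum: "hom_poly n = (\<lambda>p. \<Sum>i\<le>n. monomial (int i) (int (n - i)) p)"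
  by (rule ext) (simp only: hom_poly_def monomial_def case_prod_beta power_int_of_nat)

lemma L2_hom_poly: "hom_poly n \<in> L2 torus_measure"
  unfolding hom_poly_eq_sum by (intro L2_sum L2_monomial) simp

lemma inner_hom_poly_monomial:
  "L2_inner torus_measure (hom_poly n) (monomial a b) = (\<Sum>i\<le>n. if int i = a \<and> int (n - i) = b then 1 else 0)"
  unfolding hom_poly_eq_sum
  by (subst L2_inner_sum_left) (auto simp: L2_monomial L2_inner_monomial intro!: sum.cong)

lemma inner_hom_poly:
  "L2_inner torus_measure (hom_poly m) (hom_poly n) = (if m = n then of_real ((real \<circ> Suc) n) else 0)"
proof -
  have "L2_inner torus_measure (hom_poly m) (hom_poly n)
      = (\<Sum>j\<le>n. \<Sum>i\<le>m. if i = j \<and> m - i = n - j then 1 else 0)"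
    unfolding hom_poly_eq_sum[of n]
    by (subst L2_inner_sum_right)
       (simp_all only: L2_monomial L2_hom_poly inner_hom_poly_monomial of_nat_eq_iff)
  also have "\<dots> = (\<Sum>j\<le>n. if m = n then 1 else 0)"
  proof (rule sum.cong[OF refl])
    fix j assume j: "j \<in> {..n}"
    have "(\<Sum>i\<le>m. if i = j \<and> m - i = n - j then 1 else 0) = (\<Sum>i\<le>m. if i = j then (if m = n then 1 else 0) else (0::complex))"
      by (rule sum.cong) (use j in auto)
    then show "(\<Sum>i\<le>m. if i = j \<and> m - i = n - j then 1 else (0::complex)) = (if m = n then 1 else 0)"
      using j by (simp add: sum.delta)
  qed
  finally show ?thesis by simp
qed

interpretation torus: orthogonal_sequence torus_measure hom_poly "real \<circ> Suc"
  by unfold_locales (rule L2_hom_poly, rule inner_hom_poly, simp)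

lemma L2_T_z:
  assumes "f \<in> L2 torus_measure"
  shows "T\<^sub>z f \<in> L2 torus_measure"
proof -
  have eq: "T\<^sub>z f = (\<lambda>p. monomial 1 0 p * f p)"
    by (auto simp: T\<^sub>z_def monomial_def)
  have [measurable]: "f \<in> borel_measurable borel" using L2_measurable[OF assms] by simp
  show ?thesis
    unfolding eq
  proof (rule L2_dominatedI[OF _ L2_integrable_power2[OF assms]])
    show "AE p in torus_measure. (cmod (monomial 1 0 p * f p))\<^sup>2 \<le> (cmod (f p))\<^sup>2"
      using AE_torus_cmod_monomial[of 1 0] by eventually_elim (simp add: norm_mult)
    show "(\<lambda>p. monomial 1 0 p * f p) \<in> borel_measurable torus_measure"
      unfolding borel_measurable_torus by measurable
  qed
qed

lemma inner_T_z_hom_poly: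
  "L2_inner torus_measure (T\<^sub>z (hom_poly m)) (hom_poly n) = (if n = Suc m then of_nat (m + 1) else 0)"
proof -
  have "T\<^sub>z (hom_poly m) = (\<lambda>p. \<Sum>i\<le>m. fst p * monomial (int i) (int (m - i)) p)"
    by (auto simp: T\<^sub>z_def hom_poly_eq_sum sum_distrib_left)
  also have "\<dots> = (\<lambda>p. \<Sum>i\<le>m. monomial (int (Suc i)) (int (m - i)) p)"
    unfolding monomial_def power_int_of_nat by (simp add: mult.assoc)
  finally have "L2_inner torus_measure (T\<^sub>z (hom_poly m)) (hom_poly n)
      = (\<Sum>i\<le>m. L2_inner torus_measure (monomial (int (Suc i)) (int (m - i))) (hom_poly n))"
    by (simp only:) (subst L2_inner_sum_left, simp_all only: L2_monomial L2_hom_poly)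
  also have "\<dots> = (\<Sum>i\<le>m. \<Sum>j\<le>n. if j = Suc i \<and> n - j = m - i then 1 else 0)"
  proof (rule sum.cong[OF refl])
    fix i
    have "L2_inner torus_measure (monomial (int (Suc i)) (int (m - i))) (hom_poly n)
        = cnj (L2_inner torus_measure (hom_poly n) (monomial (int (Suc i)) (int (m - i))))"
      by (rule cnj_L2_inner[symmetric])
    also have "\<dots> = (\<Sum>j\<le>n. if j = Suc i \<and> n - j = m - i then 1 else 0)"
      unfolding inner_hom_poly_monomial cnj_sum of_nat_eq_iff by (intro sum.cong) auto
    finally show "L2_inner torus_measure (monomial (int (Suc i)) (int (m - i))) (hom_poly n)
        = (\<Sum>j\<le>n. if j = Suc i \<and> n - j = m - i then 1 else 0)" .
  qed
  also have "\<dots> = (\<Sum>i\<le>m. if n = Suc m then 1 else 0)"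
  proof (rule sum.cong[OF refl])
    fix i assume i: "i \<in> {..m}"
    have "(\<Sum>j\<le>n. if j = Suc i \<and> n - j = m - i then 1 else 0)
        = (\<Sum>j\<le>n. if j = Suc i then (if n = Suc m then 1 else 0) else (0::complex))"
      by (rule sum.cong) (use i in auto)
    then show "(\<Sum>j\<le>n. if j = Suc i \<and> n - j = m - i then 1 else (0::complex)) = (if n = Suc m then 1 else 0)"
      using i by (simp add: sum.delta)
  qed
  finally show ?thesis by simp
qed

lemma power_in_hardy_circle: "(\<lambda>z. z ^ n) \<in> hardy_circle"
proof -
  have "fourier (\<lambda>z. z powi int n) k = 0" if "k < 0" for k
    unfolding fourier_power_int using that by simp
  then show ?thesis
    using circle.L2_e[of n] by (simp add: hardy_circle_def)
qed

lemma \<H>_in_closure: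
  assumes "f \<in> \<H>"
  shows "f \<in> L2_closure_in torus_measure (L2 torus_measure) (lin_span (range hom_poly))"
  using assms by (auto simp: \<H>_def hardy_torus_def L2_closure_in_def)

lemma \<H>_L2: "f \<in> \<H> \<Longrightarrow> f \<in> L2 torus_measure"
  using \<H>_in_closure by (auto simp: L2_closure_in_def)

lemma \<H>_psum_tendsto:
  "f \<in> \<H> \<Longrightarrow> (\<lambda>N. L2_norm torus_measure (\<lambda>p. f p - torus.psum f N p)) \<longlonglongrightarrow> 0"
  by (rule torus.psum_tendsto_closure[OF \<H>_in_closure])

text \<open>
  Membership in \<open>\<H>\<close> also requires membership in the Hardy space of the torus. It follows because every
  partial sum is a combination of products \<open>z ^ i * w ^ j\<close> of functions in the Hardy space of the
  circle.
\<close>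

lemma psum_limit_in_\<H>:
  assumes g: "g \<in> L2 torus_measure"
    and lim: "(\<lambda>N. L2_norm torus_measure (\<lambda>p. g p - torus.psum u N p)) \<longlonglongrightarrow> 0"
  shows "g \<in> \<H>"
proof -
  let ?T = "{\<lambda>(z, w). f z * g w | f g. f \<in> hardy_circle \<and> g \<in> hardy_circle}"
  have approx: "\<exists>N. L2_norm torus_measure (\<lambda>p. g p - torus.psum u N p) < \<epsilon>" if "\<epsilon> > 0" for \<epsilon>
  proof -
    have "\<forall>\<^sub>F N in sequentially. L2_norm torus_measure (\<lambda>p. g p - torus.psum u N p) < \<epsilon>"
      by (rule order_tendstoD(2)[OF lim that])
    then show ?thesis by (auto simp: eventually_sequentially)
  qed
  have "torus.psum u N \<in> lin_span ?T" for N
  proof -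
    define c where "c x = torus.coef u (fst x)" for x :: "nat \<times> nat"
    have "torus.psum u N = (\<lambda>p. \<Sum>x\<in>Sigma {..<N} (\<lambda>n. {..n}). c x * (\<lambda>(z, w). z ^ snd x * w ^ (fst x - snd x)) p)"
    proof
      fix p
      have "torus.psum u N p = (\<Sum>n<N. \<Sum>i\<le>n. torus.coef u n * (\<lambda>(z, w). z ^ i * w ^ (n - i)) p)"
        by (simp add: torus.psum_def sum_distrib_left split_def hom_poly_def[THEN fun_cong])
      also have "\<dots> = (\<Sum>(n, i)\<in>Sigma {..<N} (\<lambda>n. {..n}). torus.coef u n * (\<lambda>(z, w). z ^ i * w ^ (n - i)) p)"
        by (rule sum.Sigma) auto
      finally show "torus.psum u N p
          = (\<Sum>x\<in>Sigma {..<N} (\<lambda>n. {..n}). c x * (\<lambda>(z, w). z ^ snd x * w ^ (fst x - snd x)) p)"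
        by (simp add: c_def split_def)
    qed
    also have "\<dots> \<in> lin_span ?T"
    proof (rule lin_span_sum)
      show "(\<lambda>(z, w). z ^ snd x * w ^ (fst x - snd x)) \<in> ?T" for x :: "nat \<times> nat"
        by (intro CollectI exI[of _ "\<lambda>z. z ^ snd x"] exI[of _ "\<lambda>w. w ^ (fst x - snd x)"] conjI
            power_in_hardy_circle refl)
    qed auto
    finally show ?thesis .
  qed
  then have "g \<in> hardy_torus"
    using g approx unfolding hardy_torus_def L2_closure_in_def by blast
  then show ?thesis
    using approx torus.psum_in_lin_span unfolding \<H>_def L2_closure_in_def by blast
qed

section \<open>The Bergman shift\<close>

text \<open>
  The adjoint of multiplication by \<open>z\<close> is multiplication by \<open>cnj z\<close>. Expanding \<open>f\<close>, only the term of
  degree \<open>k - 1\<close> survives, since multiplication by \<open>z\<close> raises the degree by one. The inner product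
  of \<open>z * p\<^bsub>k - 1\<^esub>\<close> with \<open>p\<^sub>k\<close> is \<open>k\<close>, the squared norm of \<open>p\<^bsub>k - 1\<^esub>\<close>, so no weight remains.
\<close>

lemma T_z_coefficient:
  assumes f: "f \<in> \<H>"
  shows "L2_inner torus_measure (T\<^sub>z f) (hom_poly k)
    = (case k of 0 \<Rightarrow> 0 | Suc k \<Rightarrow> L2_inner torus_measure f (hom_poly k))"
proof -
  define v where "v p = cnj (fst p) * hom_poly k p" for p
  have adj: "L2_inner torus_measure (T\<^sub>z g) (hom_poly k) = L2_inner torus_measure g v" for g
    unfolding L2_inner_def
    by (intro Bochner_Integration.integral_cong) (auto simp: T\<^sub>z_def v_def mult_ac)
  have v: "v \<in> L2 torus_measure"
  proof (rule L2_dominatedI[OF _ L2_integrable_power2[OF L2_hom_poly[of k]]])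
    show "AE p in torus_measure. (cmod (v p))\<^sup>2 \<le> (cmod (hom_poly k p))\<^sup>2"
      using AE_torus_cmod by eventually_elim (simp add: v_def norm_mult)
    have [measurable]: "(\<lambda>p. fst p) \<in> measurable (borel :: (complex \<times> complex) measure) borel"
      by (auto intro!: borel_measurable_continuous_onI continuous_intros)
    have [measurable]: "hom_poly k \<in> borel_measurable borel" 
      using L2_measurable[OF L2_hom_poly[of k]] by simp
    show "v \<in> borel_measurable torus_measure"
      unfolding borel_measurable_torus v_def[abs_def] by measurable
  qed
  have "(\<lambda>n. torus.coef f n * L2_inner torus_measure (hom_poly n) v) sums L2_inner torus_measure f v"
    by (rule torus.Parseval[OF \<H>_L2[OF f] \<H>_psum_tendsto[OF f] v])
  then have s: "(\<lambda>n. torus.coef f n * (if k = Suc n then of_nat (n + 1) else 0)) sums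
      L2_inner torus_measure (T\<^sub>z f) (hom_poly k)"
    unfolding adj[symmetric] inner_T_z_hom_poly .
  show ?thesis
  proof (cases k)
    case 0
    with s have "(\<lambda>n. 0) sums L2_inner torus_measure (T\<^sub>z f) (hom_poly k)" by simp
    then show ?thesis using 0 by (simp add: sums_iff)
  next
    case (Suc k')
    have "(\<lambda>n. torus.coef f n * (if k = Suc n then of_nat (n + 1) else 0))
        = (\<lambda>n. if n = k' then torus.coef f n * of_nat (n + 1) else 0)"
      using Suc by auto
    with s have "(\<lambda>n. if n = k' then torus.coef f n * of_nat (n + 1) else 0) sums
      L2_inner torus_measure (T\<^sub>z f) (hom_poly k)" by simp
    then have "L2_inner torus_measure (T\<^sub>z f) (hom_poly k) = torus.coef f k' * of_nat (k' + 1)"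
      using sums_single[of k' "\<lambda>n. torus.coef f n * of_nat (n + 1)"] sums_unique2 by blast
    also have "\<dots> = L2_inner torus_measure f (hom_poly k')"
      by (simp add: torus.coef_def del: of_nat_Suc)
    finally show ?thesis using Suc by simp
  qed
qed

text \<open>
  The Bergman shift is defined by a choice of a projection; the projection onto the closed span of
  the \<open>p\<^sub>n\<close> shows that the choice is possible. Measured by inner products with the unnormalized \<open>p\<^sub>k\<close>,
  the Bergman shift is an unweighted shift.
\<close>

lemma bergman_shift_\<H>:
  assumes f: "f \<in> \<H>"
  shows "bergman_shift f \<in> \<H>"
    and "L2_inner torus_measure (bergman_shift f) (hom_poly k)
      = (case k of 0 \<Rightarrow> 0 | Suc k \<Rightarrow> L2_inner torus_measure f (hom_poly k))"
proof -
  have TL2: "T\<^sub>z f \<in> L2 torus_measure" by (rule L2_T_z[OF \<H>_L2[OF f]])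
  obtain g where g: "g \<in> L2 torus_measure"
    and lim: "(\<lambda>N. L2_norm torus_measure (\<lambda>p. g p - torus.psum (T\<^sub>z f) N p)) \<longlonglongrightarrow> 0"
    and orth: "\<And>k. L2_inner torus_measure (\<lambda>p. T\<^sub>z f p - g p) (hom_poly k) = 0"
    by (rule torus.projection_exists[OF TL2], rule that)
  have "g \<in> \<H>" by (rule psum_limit_in_\<H>[OF g lim])
  moreover have "L2_inner torus_measure (\<lambda>p. T\<^sub>z f p - g p) h = 0" if "h \<in> \<H>" for h
    by (rule L2_inner_closure_span_eq_0[OF L2_diff[OF TL2 g] _ _ _ \<H>_in_closure[OF that]])
       (use orth L2_hom_poly in auto)
  ultimately have "g \<in> \<H> \<and> (\<forall>h\<in>\<H>. L2_inner torus_measure (\<lambda>p. T\<^sub>z f p - g p) h = 0)" by blast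
  then have *: "bergman_shift f \<in> \<H> \<and> (\<forall>h\<in>\<H>. L2_inner torus_measure (\<lambda>p. T\<^sub>z f p - bergman_shift f p) h = 0)"
    unfolding bergman_shift_def orth_proj_def
    by (rule someI[of "\<lambda>g. g \<in> \<H> \<and> (\<forall>h\<in>\<H>. L2_inner torus_measure (\<lambda>p. T\<^sub>z f p - g p) h = 0)"])
  then show mem: "bergman_shift f \<in> \<H>" by blast
  have "hom_poly k \<in> \<H>"
  proof (rule psum_limit_in_\<H>[OF L2_hom_poly, of _ "hom_poly k"])
    have "hom_poly k \<in> L2_closure_in torus_measure (L2 torus_measure) (lin_span (range hom_poly))"
    proof -
      have "hom_poly k \<in> lin_span (range hom_poly)"
        using lin_span_sum[of "{k}" hom_poly "range hom_poly" "\<lambda>_. 1"] by simp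
      moreover have "L2_norm torus_measure (\<lambda>p. hom_poly k p - hom_poly k p) = 0"
        by (simp add: L2_norm_def)
      ultimately show ?thesis
        using L2_hom_poly[of k] unfolding L2_closure_in_def by (auto intro!: bexI[of _ "hom_poly k"])
    qed
    then show "(\<lambda>N. L2_norm torus_measure (\<lambda>p. hom_poly k p - torus.psum (hom_poly k) N p)) \<longlonglongrightarrow> 0"
      by (rule torus.psum_tendsto_closure)
  qed
  with * have "L2_inner torus_measure (\<lambda>p. T\<^sub>z f p - bergman_shift f p) (hom_poly k) = 0" by blast
  then have "L2_inner torus_measure (bergman_shift f) (hom_poly k) = L2_inner torus_measure (T\<^sub>z f) (hom_poly k)"
    using L2_inner_diff_left[OF TL2 \<H>_L2[OF mem] L2_hom_poly, of k] by simp
  then show "L2_inner torus_measure (bergman_shift f) (hom_poly k)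
      = (case k of 0 \<Rightarrow> 0 | Suc k \<Rightarrow> L2_inner torus_measure f (hom_poly k))"
    unfolding T_z_coefficient[OF f] .
qed

lemma bergman_shift_funpow:
  assumes f: "f \<in> \<H>"
  shows "(bergman_shift ^^ m) f \<in> \<H> \<and> (\<forall>k. L2_inner torus_measure ((bergman_shift ^^ m) f) (hom_poly k)
    = (if k < m then 0 else L2_inner torus_measure f (hom_poly (k - m))))"
proof (induction m)
  case 0
  then show ?case using f by simp
next
  case (Suc m)
  then show ?case
    using bergman_shift_\<H>[of "(bergman_shift ^^ m) f"] by (auto split: nat.split)
qed

section \<open>The restriction to the line where z vanishes\<close>

lemma at_z_zero_eq: "at_z_zero q w = (LINT z|circle_measure. q (z, w))"
  by (simp add: at_z_zero_def hardy_value_def)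

lemma torus_integrable_section:
  fixes q :: "complex \<times> complex \<Rightarrow> 'b :: {banach, second_countable_topology}"
  assumes "integrable torus_measure q"
  shows "AE w in circle_measure. integrable circle_measure (\<lambda>z. q (z, w))"
    and "integrable circle_measure (\<lambda>w. LINT z|circle_measure. q (z, w))"
    and "(LINT w|circle_measure. (LINT z|circle_measure. q (z, w))) = (LINT p|torus_measure. q p)"
proof -
  have "integrable (circle_measure \<Otimes>\<^sub>M circle_measure) (\<lambda>(z, w). q (z, w))"
    using assms by (simp add: torus_measure_def split_def)
  note * = circle_pair.AE_integrable_snd[OF this] circle_pair.integrable_snd[OF this] circle_pair.integral_snd[OF this]
  from * show "AE w in circle_measure. integrable circle_measure (\<lambda>z. q (z, w))"
    and "integrable circle_measure (\<lambda>w. LINT z|circle_measure. q (z, w))"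
    and "(LINT w|circle_measure. (LINT z|circle_measure. q (z, w))) = (LINT p|torus_measure. q p)"
    by (simp_all add: torus_measure_def split_def)
qed

text \<open>
  For almost every \<open>w\<close>, the square of a mean over \<open>z\<close> is at most the mean of the squares.
\<close>

lemma L2_at_z_zero:
  assumes q: "q \<in> L2 torus_measure"
  shows "at_z_zero q \<in> L2 circle_measure"
proof (rule L2_dominatedI)
  have int: "integrable torus_measure q" by (rule torus.L2_integrable[OF q])
  have [measurable]: "q \<in> borel_measurable (circle_measure \<Otimes>\<^sub>M circle_measure)"
    using L2_measurable[OF q] by (simp add: torus_measure_def)
  note sq = torus_integrable_section[OF L2_integrable_power2[OF q]]
  show "integrable circle_measure (\<lambda>w. LINT z|circle_measure. (cmod (q (z, w)))\<^sup>2)" by (rule sq(2))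
  show "at_z_zero q \<in> borel_measurable circle_measure"
    using borel_measurable_integrable[OF torus_integrable_section(2)[OF int]] by (simp add: at_z_zero_eq[abs_def])
  show "AE w in circle_measure. (cmod (at_z_zero q w))\<^sup>2 \<le> (LINT z|circle_measure. (cmod (q (z, w)))\<^sup>2)"
    using sq(1)
  proof eventually_elim
    fix w assume i: "integrable circle_measure (\<lambda>z. (cmod (q (z, w)))\<^sup>2)"
    have "(\<lambda>z. q (z, w)) \<in> borel_measurable circle_measure" by measurable
    then have s: "(\<lambda>z. q (z, w)) \<in> L2 circle_measure" using i by (simp add: L2_def)
    have "cmod (at_z_zero q w) \<le> L2_norm circle_measure (\<lambda>z. q (z, w)) * L2_norm circle_measure (\<lambda>z. 1)"
      using L2_Cauchy_Schwarz[OF s circle.L2_const[of 1]] by (simp add: L2_inner_def at_z_zero_eq)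
    also have "L2_norm circle_measure (\<lambda>z. 1) = 1"
      using circle.prob_space by (simp add: L2_norm_def)
    finally have "(cmod (at_z_zero q w))\<^sup>2 \<le> (L2_norm circle_measure (\<lambda>z. q (z, w)))\<^sup>2"
      by (intro power_mono) simp_all
    then show "(cmod (at_z_zero q w))\<^sup>2 \<le> (LINT z|circle_measure. (cmod (q (z, w)))\<^sup>2)"
      by (simp add: L2_norm_power2)
  qed
qed

text \<open>
  By Fubini's theorem the Fourier coefficient is the inner product of \<open>q\<close> with \<open>w ^ n\<close>, and \<open>w ^ n\<close>
  has inner product \<open>1\<close> with \<open>p\<^sub>n\<close> and \<open>0\<close> with all other \<open>p\<^sub>k\<close>.
\<close>

lemma fourier_at_z_zero:
  assumes q: "q \<in> \<H>"
  shows "fourier (at_z_zero q) n = (if n < 0 then 0 else torus.coef q (nat n))"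
proof -
  have qL2: "q \<in> L2 torus_measure" by (rule \<H>_L2[OF q])
  have "fourier (at_z_zero q) n = (LINT w|circle_measure. (LINT z|circle_measure. q (z, w) * cnj (monomial 0 n (z, w))))"
    by (simp add: fourier_def L2_inner_def at_z_zero_eq monomial_def)
  also have "\<dots> = L2_inner torus_measure q (monomial 0 n)"
    unfolding L2_inner_def by (rule torus_integrable_section(3)[OF integrable_L2_inner[OF qL2 L2_monomial]])
  finally have eq: "fourier (at_z_zero q) n = L2_inner torus_measure q (monomial 0 n)" .
  have "L2_inner torus_measure (hom_poly k) (monomial 0 n) = (if int k = n then 1 else 0)" for k
  proof -
    have "L2_inner torus_measure (hom_poly k) (monomial 0 n) = (\<Sum>i\<le>k. if i = 0 then (if int k = n then 1 else 0) else 0)"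
      unfolding inner_hom_poly_monomial by (intro sum.cong) auto
    then show ?thesis by (simp add: sum.delta)
  qed
  then have s: "(\<lambda>k. torus.coef q k * (if int k = n then 1 else 0)) sums fourier (at_z_zero q) n"
    using torus.Parseval[OF qL2 \<H>_psum_tendsto[OF q] L2_monomial[of 0 n]] unfolding eq by simp
  show ?thesis
  proof (cases "n < 0")
    case True
    then have "(\<lambda>k. torus.coef q k * (if int k = n then 1 else 0)) = (\<lambda>k. 0)" by auto
    with s show ?thesis using True by (simp add: sums_iff)
  next
    case False
    then have "(\<lambda>k. torus.coef q k * (if int k = n then 1 else 0)) = (\<lambda>k. if k = nat n then torus.coef q k else 0)"
      by (auto simp: fun_eq_iff)
    with s have "(\<lambda>k. if k = nat n then torus.coef q k else 0) sums fourier (at_z_zero q) n" by simp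
    then show ?thesis
      using sums_single[of "nat n" "torus.coef q"] sums_unique2 False by auto
  qed
qed

section \<open>Wandering subspaces of the Bergman shift\<close>

theorem theorem2p2:
  fixes M :: "(complex \<times> complex \<Rightarrow> complex) set"
    and q :: "complex \<times> complex \<Rightarrow> complex"
  assumes "invariant_subspace M"
    and "q \<in> wandering_subspace M"
  shows "\<exists>c::real. AE w in circle_measure.
           (\<lambda>j. (cmod ((backward_shift ^^ j) (at_z_zero q) w))\<^sup>2) sums c"
proof (rule backward_shift_orbit_constant)
  have q: "q \<in> M" and orth: "\<And>h. h \<in> M \<Longrightarrow> L2_inner torus_measure q (bergman_shift h) = 0"
    using assms(2) by (auto simp: wandering_subspace_def)
  have MH: "M \<subseteq> \<H>" and inv: "\<And>h. h \<in> M \<Longrightarrow> bergman_shift h \<in> M"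
    using assms(1) by (auto simp: invariant_subspace_def)
  have qH: "q \<in> \<H>" using q MH by blast
  have qL2: "q \<in> L2 torus_measure" by (rule \<H>_L2[OF qH])
  have fourier: "fourier (at_z_zero q) (int n) = torus.coef q n" for n
    by (simp add: fourier_at_z_zero[OF qH])
  show "at_z_zero q \<in> hardy_circle"
    using L2_at_z_zero[OF qL2] by (simp add: hardy_circle_def fourier_at_z_zero[OF qH])
  show "summable (\<lambda>n. real (n + 1) * (cmod (fourier (at_z_zero q) (int n)))\<^sup>2)"
    using torus.summable_coef[OF qL2] by (simp add: fourier mult.commute)
  fix m :: nat assume m: "m \<ge> 1"
  have iter: "(bergman_shift ^^ k) q \<in> M" for k
    by (induction k) (simp_all add: q inv)
  have "(bergman_shift ^^ m) q = bergman_shift ((bergman_shift ^^ (m - 1)) q)"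
    using m by (cases m) simp_all
  then have 0: "L2_inner torus_measure q ((bergman_shift ^^ m) q) = 0"
    using orth[OF iter] by simp
  have BL2: "(bergman_shift ^^ m) q \<in> L2 torus_measure"
    using iter MH \<H>_L2 by blast
  \<comment> \<open>the terms of Parseval's formula for the inner product of \<open>q\<close> and \<open>B ^ m q\<close>; the first \<open>m\<close> vanish\<close>
  define b where "b n = torus.coef q n * L2_inner torus_measure (hom_poly n) ((bergman_shift ^^ m) q)" for n
  have "b sums 0"
    using torus.Parseval[OF qL2 \<H>_psum_tendsto[OF qH] BL2] unfolding 0 b_def .
  moreover have inner: "L2_inner torus_measure (hom_poly n) ((bergman_shift ^^ m) q)
      = (if n < m then 0 else cnj (L2_inner torus_measure q (hom_poly (n - m))))" for n
    using bergman_shift_funpow[OF qH, of m] cnj_L2_inner[of torus_measure "(bergman_shift ^^ m) q" "hom_poly n"]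
    by (metis complex_cnj_zero)
  moreover have "b n = 0" if "n < m" for n using that by (simp add: b_def inner)
  ultimately have "(\<lambda>n. b (n + m)) sums 0" by (simp add: sums_zero_iff_shift)
  moreover have "b (n + m) = of_nat (n + 1) * (fourier (at_z_zero q) (int (n + m)) * cnj (fourier (at_z_zero q) (int n)))" for n
  proof -
    have "L2_inner torus_measure q (hom_poly n) = of_nat (n + 1) * torus.coef q n"
      by (simp add: torus.coef_def del: of_nat_Suc)
    then show ?thesis
      by (simp add: b_def inner fourier mult_ac del: of_nat_Suc of_nat_add)
  qed
  ultimately show "(\<lambda>n. of_nat (n + 1) * (fourier (at_z_zero q) (int (n + m)) * cnj (fourier (at_z_zero q) (int n)))) sums 0"
    by simp
qed

end
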